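(* Let $h\ge 0$, $\eta>0$, $\kappa>0$, and let $K:\mathbb{R}\to\mathbb{R}$ satisfy $K\ge 0$, $\int_{\mathbb{R}}K(s)ds=1$ and $\operatorname{supp}K\subseteq[-\eta,\eta]$. Let $g:\mathbb{R}_+\to\mathbb{R}_+$ be continuous, with $g(\kappa)=\kappa$, $g$ differentiable at $\kappa$ and $g'(\kappa)<0$. Suppose that for some fixed $c=\bar c>0$ the equation $$(z/c)^2-z-1+g'(\kappa)e^{-zh}\int_{-\eta}^{\eta}K(s)e^{-zs/c}\,ds=0$$ does not have any root $z$ in $(-\infty,0)$. If $u(t,x)=\phi(x+\bar ct)$ is a non-constant (non-negative) solution of $$u_t(t,x)=u_{xx}(t,x)-u(t,x)+\int_{\mathbb{R}}K(x-y)g(u(t-h,y))\,dy$$ with $\phi(+\infty)=\kappa$, then $\phi(s)$ oscillates about $\kappa$.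
   Context: "$\phi$ oscillates about $\kappa$" means that $\phi-\kappa$ takes both positive and negative values on every half-line $[T,+\infty)$. Solutions are classical; $\mathbb{R}_+=[0,\infty)$. *)

theory Defs
  imports "HOL-Analysis.Analysis"
begin

text \<open>
  Classical solutions, on the whole plane, of
  \<open>u\<^sub>t(t,x) = u\<^sub>x\<^sub>x(t,x) - u(t,x) + \<integral> K(x - y) g(u(t - h, y)) dy\<close>.
  The derivatives \<open>u\<^sub>t\<close>, \<open>u\<^sub>x\<close>, \<open>u\<^sub>x\<^sub>x\<close> are required to be jointly continuous. Integrability of
  the integrand is demanded explicitly because the Bochner integral of a non-integrable function
  is \<open>0\<close> by convention; for an integrable compactly supported \<open>K\<close> and a continuous \<open>g\<close> on
  \<open>[0,\<infinity>)\<close> it is automatic for non-negative \<open>u\<close>.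
\<close>

definition classical_solution ::
  "real \<Rightarrow> (real \<Rightarrow> real) \<Rightarrow> (real \<Rightarrow> real) \<Rightarrow> (real \<Rightarrow> real \<Rightarrow> real) \<Rightarrow> bool"
where
  "classical_solution h K g u \<longleftrightarrow>
     (\<exists>ut ux uxx.
        continuous_on UNIV (\<lambda>(t, x). ut t x) \<and>
        continuous_on UNIV (\<lambda>(t, x). ux t x) \<and>
        continuous_on UNIV (\<lambda>(t, x). uxx t x) \<and>
        (\<forall>t x.
           ((\<lambda>t'. u t' x) has_real_derivative ut t x) (at t) \<and>
           ((\<lambda>x'. u t x') has_real_derivative ux t x) (at x) \<and>
           ((\<lambda>x'. ux t x') has_real_derivative uxx t x) (at x) \<and>
           integrable lebesgue (\<lambda>y. K (x - y) * g (u (t - h) y)) \<and>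
           ut t x = uxx t x - u t x + (LINT y|lebesgue. K (x - y) * g (u (t - h) y))))"

definition oscillates_about :: "(real \<Rightarrow> real) \<Rightarrow> real \<Rightarrow> bool" where
  "oscillates_about \<phi> \<kappa> \<longleftrightarrow>
     (\<forall>T. (\<exists>s\<ge>T. \<phi> s - \<kappa> > 0) \<and> (\<exists>s\<ge>T. \<phi> s - \<kappa> < 0))"

end

theory Submission
  imports Defs "HOL-Probability.Probability" "HOL-Real_Asymp.Real_Asymp"
begin

text \<open>
  With \<open>v = \<phi> - \<kappa>\<close>, \<open>G x = g (\<kappa> + x) - \<kappa>\<close> and \<open>M\<close> the law of \<open>c h + w\<close> when \<open>w\<close> has density \<open>K\<close>,
  the profile equation reads \<open>v'' - c v' - v + \<integral> G (v (s - \<tau>)) dM \<tau> = 0\<close>. Put \<open>z = - c x\<close> and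
  \<open>p = - g' \<kappa>\<close>: absence of negative roots means \<open>x\<^sup>2 + c x - 1 < p k x\<close> for all \<open>x \<ge> 0\<close>, where
  \<open>k x = \<integral> exp (x \<tau>) dM \<tau>\<close>. This forces \<open>M\<close> to charge \<open>(0, \<infinity>)\<close>, so \<open>k\<close> grows exponentially and
  the inequality survives, with a gap \<open>\<delta>\<close>, for some \<open>q' < p\<close>.

  If \<open>v\<close> does not oscillate, \<open>y = \<bar>v\<bar>\<close> eventually satisfies \<open>y'' - c y' - y \<ge> q \<integral> y (s - \<tau>) dM \<tau>\<close> with
  \<open>q' < q < p\<close>. Instead of analysing the decay rate of \<open>y\<close>, one tests against a Gaussian weight whose
  logarithmic derivative \<open>\<rho> max 0 (Q - s)\<close> sweeps slowly through all rates \<open>x \<ge> 0\<close>: locally the weight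
  is an exponential, so the gap applies at every point. Letting \<open>Q \<rightarrow> \<infinity>\<close> shows that \<open>y\<close> vanishes
  eventually. Then \<open>G \<circ> v\<close> has vanishing convolution with \<open>M\<close> on a half-line, and a Laplace transform
  argument of Titchmarsh type pushes the zero set of \<open>v\<close> to the left by a fixed amount as long as
  \<open>v\<close> is small there, so \<open>v\<close> vanishes identically.
\<close>

section \<open>Uniqueness from bounded exponential moments\<close>

lemma mikusinski_vanishing:
  fixes f :: "real \<Rightarrow> real"
  assumes f: "continuous_on {a..b} f"
    and bound: "\<And>n::nat. \<bar>integral {a..b} (\<lambda>r. exp (real n * (r - a)) * f r)\<bar> \<le> C"
    and r: "r \<in> {a<..<b}"
  shows "f r = 0"
proof -
  \<comment> \<open>Expand \<open>1 - exp (- exp (n (r - t)))\<close>, which tends to the indicator of \<open>r > t\<close>, in powers of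
    \<open>exp (n (r - t))\<close>: the bound makes the integral of each term against \<open>f\<close> small for \<open>t > a\<close>.\<close>
  define E where "E n t r = exp (real n * (r - t))" for n :: nat and t r :: real
  define P where "P N n t r = (\<Sum>k<N. - ((- E n t r) ^ Suc k) / fact (Suc k)) * f r" for N n :: nat and t r :: real
  have contE [continuous_intros]: "continuous_on A (\<lambda>r. E n t r)" for A n t
    unfolding E_def by (intro continuous_intros)
  \<comment> \<open>Renormalising the exponential at \<open>a\<close> instead of \<open>t\<close>
    turns the \<open>Suc k\<close>-th power of \<open>E n t\<close> into an instance of
    \<open>bound\<close> at the integer rate \<open>n * Suc k\<close>, times a factor that is small
    for \<open>t > a\<close>.\<close>
  have term_int: "integral {a..b} (\<lambda>r. - ((- E n t r) ^ Suc k) / fact (Suc k) * f r)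
      = - ((-1) ^ Suc k) / fact (Suc k) * exp (- (real (n * Suc k) * (t - a)))
         * integral {a..b} (\<lambda>r. exp (real (n * Suc k) * (r - a)) * f r)" for n t k
  proof -
    have e: "E n t r ^ Suc k = exp (- (real (n * Suc k) * (t - a))) * exp (real (n * Suc k) * (r - a))" for r
      unfolding E_def exp_of_nat_mult[symmetric] exp_add[symmetric] by (simp add: algebra_simps)
    have "- ((- E n t r) ^ Suc k) / fact (Suc k) * f r
       = (- ((-1) ^ Suc k) / fact (Suc k) * exp (- (real (n * Suc k) * (t - a))))
         * (exp (real (n * Suc k) * (r - a)) * f r)" for r
      unfolding power_minus[of "E n t r"] e by simp
    then show ?thesis by (simp only: integral_mult_right)
  qed
  have P_int: "P N n t integrable_on {a..b}" for N n t
    unfolding P_def by (intro integrable_continuous_real continuous_intros f) auto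
  have exp_partial: "(\<Sum>k<N. z ^ Suc k / fact (Suc k)) \<le> exp z - 1" if "z \<ge> 0" for z :: real and N
  proof -
    have s: "(\<lambda>n. z ^ n / fact n) sums exp z"
      using exp_converges[of z] by (simp add: field_simps)
    have "(\<Sum>k<Suc N. z ^ k / fact k) \<le> exp z"
      using sum_le_suminf[of "\<lambda>n. z ^ n / fact n" "{..<Suc N}"] s that sums_unique[OF s]
      by (auto simp: sums_iff)
    then show ?thesis unfolding sum.lessThan_Suc_shift by (simp del: power_Suc fact_Suc sum.lessThan_Suc)
  qed
  have C0: "C \<ge> 0" using bound[of 0] by (meson abs_ge_zero order_trans)
  \<comment> \<open>The absolute values add up to a partial sum of exp z - 1 at z = exp (- n (t -
    a)). The bound is uniform in \<open>N\<close>, and for \<open>t > a\<close> it tends to 0 with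
    \<open>n\<close>.\<close>
  have P_bound: "\<bar>integral {a..b} (P N n t)\<bar> \<le> C * (exp (exp (- (real n * (t - a)))) - 1)" for N n t
  proof -
    let ?z = "exp (- (real n * (t - a)))"
    have "integral {a..b} (P N n t) = (\<Sum>k<N. integral {a..b} (\<lambda>r. - ((- E n t r) ^ Suc k) / fact (Suc k) * f r))"
      unfolding P_def sum_distrib_right
      by (intro integral_sum integrable_continuous_real continuous_intros f) auto
    also have "\<bar>\<dots>\<bar> \<le> (\<Sum>k<N. ?z ^ Suc k / fact (Suc k) * C)"
    proof (intro order.trans[OF sum_abs] sum_mono)
      fix k
      have "exp (- (real (n * Suc k) * (t - a))) = ?z ^ Suc k"
        unfolding exp_of_nat_mult[symmetric] by (simp add: algebra_simps)
      then show "\<bar>integral {a..b} (\<lambda>r. - ((- E n t r) ^ Suc k) / fact (Suc k) * f r)\<bar>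
          \<le> ?z ^ Suc k / fact (Suc k) * C"
        unfolding term_int using mult_left_mono[OF bound[of "n * Suc k"], of "?z ^ Suc k / fact (Suc k)"]
        by (simp add: abs_mult power_abs del: power_Suc of_nat_mult of_nat_Suc fact_Suc)
    qed
    also have "\<dots> = C * (\<Sum>k<N. ?z ^ Suc k / fact (Suc k))"
      by (simp only: sum_distrib_left mult.commute)
    also have "\<dots> \<le> C * (exp ?z - 1)"
      by (intro mult_left_mono exp_partial C0) auto
    finally show ?thesis .
  qed
  define H where "H n t r = (1 - exp (- E n t r)) * f r" for n t r
  have P_lim: "(\<lambda>N. integral {a..b} (P N n t)) \<longlonglongrightarrow> integral {a..b} (H n t)" for n t
  proof (rule dominated_convergence(2))
    show "(\<lambda>r. exp (E n t r) * \<bar>f r\<bar>) integrable_on {a..b}"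
      by (intro integrable_continuous_real continuous_intros f)
    fix N r
    have "\<bar>\<Sum>k<N. - ((- E n t r) ^ Suc k) / fact (Suc k)\<bar> \<le> (\<Sum>k<N. E n t r ^ Suc k / fact (Suc k))"
      by (rule order.trans[OF sum_abs]) (simp add: E_def abs_mult power_abs del: fact_Suc)
    also have "\<dots> \<le> exp (E n t r)"
      using exp_partial[of "E n t r" N] by (simp add: E_def)
    finally show "norm (P N n t r) \<le> exp (E n t r) * \<bar>f r\<bar>"
      unfolding P_def real_norm_def abs_mult by (intro mult_right_mono) auto
  next
    fix r
    have s: "(\<lambda>k. (- E n t r) ^ k / fact k) sums exp (- E n t r)"
      using exp_converges[of "- E n t r"] by (simp add: field_simps)
    have "(\<lambda>k. (- E n t r) ^ Suc k / fact (Suc k)) sums (exp (- E n t r) - 1)"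
      using s by (subst sums_Suc_iff) simp
    from sums_minus[OF this] have "(\<lambda>k. - ((- E n t r) ^ Suc k) / fact (Suc k)) sums (1 - exp (- E n t r))"
      by (simp del: power_Suc fact_Suc)
    then show "(\<lambda>N. P N n t r) \<longlonglongrightarrow> H n t r"
      unfolding P_def H_def sums_def by (intro tendsto_intros)
  qed (rule P_int)
  have H_bound: "\<bar>integral {a..b} (H n t)\<bar> \<le> C * (exp (exp (- (real n * (t - a)))) - 1)" for n t
    by (rule LIMSEQ_le_const2[OF tendsto_rabs[OF P_lim]]) (auto intro: P_bound)
  have tail0: "integral {t..b} f = 0" if t: "t \<in> {a<..<b}" for t
  proof -
    \<comment> \<open>At \<open>r = t\<close> the factor equals 1 - exp (-1) for every
      \<open>n\<close>; this single point is removed below as a null set.\<close>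
    define L where "L r = (if r < t then 0 else if r = t then (1 - exp (-1)) * f r else f r)" for r
    have lim: "(\<lambda>n. integral {a..b} (H n t)) \<longlonglongrightarrow> integral {a..b} L"
    proof (rule dominated_convergence(2))
      show "H n t integrable_on {a..b}" for n
        unfolding H_def by (intro integrable_continuous_real continuous_intros f)
      show "(\<lambda>r. \<bar>f r\<bar>) integrable_on {a..b}"
        by (intro integrable_continuous_real continuous_intros f)
      show "norm (H n t r) \<le> \<bar>f r\<bar>" for n r
        unfolding H_def real_norm_def abs_mult
        by (rule mult_left_le_one_le) (auto simp: E_def)
      fix r
      have "(\<lambda>n. 1 - exp (- exp (real n * (r - t)))) \<longlonglongrightarrow> 0" if "r < t"
        using that by real_asymp
      moreover have "(\<lambda>n. 1 - exp (- exp (real n * (r - t)))) \<longlonglongrightarrow> 1" if "r > t"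
        using that by real_asymp
      ultimately show "(\<lambda>n. H n t r) \<longlonglongrightarrow> L r"
        unfolding H_def L_def E_def
        using tendsto_mult[OF _ tendsto_const[of "f r"]] by (cases r t rule: linorder_cases) fastforce+
    qed
    have "(\<lambda>n. C * (exp (exp (- (real n * (t - a)))) - 1)) \<longlonglongrightarrow> C * (exp 0 - 1)"
    proof (intro tendsto_intros)
      show "(\<lambda>n. exp (- (real n * (t - a)))) \<longlonglongrightarrow> 0"
        using t by (auto simp: greaterThanLessThan_iff) real_asymp
    qed
    then have "(\<lambda>n. integral {a..b} (H n t)) \<longlonglongrightarrow> 0"
      using H_bound by (intro Lim_null_comparison[of "\<lambda>n. integral {a..b} (H n t)"]) auto
    with lim have "integral {a..b} L = 0" by (rule LIMSEQ_unique)
    moreover have "integral {a..b} L = integral {a..b} (\<lambda>r. if r \<in> {t..b} then f r else 0)"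
      by (rule integral_spike[of "{t}"]) (auto simp: L_def)
    moreover have "\<dots> = integral ({t..b} \<inter> {a..b}) f"
      by (simp only: integral_restrict_Int)
    moreover have "{t..b} \<inter> {a..b} = {t..b}" using t by auto
    ultimately show ?thesis by (simp only:)
  qed
  have "((\<lambda>t. integral {t..b} f) has_real_derivative - f r) (at r within {a..b})"
    using integral_has_vector_derivative'[OF f, of r] r 
    by (auto simp: has_real_derivative_iff_has_vector_derivative)
  then have "((\<lambda>t. integral {t..b} f) has_real_derivative - f r) (at r)"
    using r at_within_Icc_at[of a r b] by simp
  moreover have "((\<lambda>t. integral {t..b} f) has_real_derivative 0) (at r)"
    by (rule has_field_derivative_transform_within_open[of "\<lambda>_. 0" _ _ "{a<..<b}"])
       (use r tail0 in auto)
  ultimately have "- f r = 0" by (rule DERIV_unique)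
  then show ?thesis by simp
qed

section \<open>Compactly supported delay laws: integrability, continuity, Fubini\<close>

text \<open>The analysis sees the kernel and the time delay only through one probability law of
  bounded support; the density \<open>K\<close> enters again when the law is constructed.\<close>

locale compact_law = prob_space M for M :: "real measure" +
  fixes D :: real
  assumes sets_M: "sets M = sets borel"
    and support: "AE \<tau> in M. \<tau> \<in> {-D..D}"
begin

lemma space_M: "space M = UNIV"
  using sets_eq_imp_space_eq[OF sets_M] by simp

lemma borel_M: "borel_measurable M = borel_measurable borel"
  by (rule measurable_cong_sets[OF sets_M refl])

lemma integrable_continuous:
  fixes f :: "real \<Rightarrow> real"
  assumes f: "continuous_on UNIV f"
  shows "integrable M f"
proof -
  have "compact (f ` {-D..D})"
    by (rule compact_continuous_image[OF continuous_on_subset[OF f]]) auto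
  then obtain B where B: "\<And>x. x \<in> {-D..D} \<Longrightarrow> \<bar>f x\<bar> \<le> B"
    using compact_imp_bounded[of "f ` {-D..D}"] unfolding bounded_iff real_norm_def by blast
  show ?thesis
  proof (rule integrable_const_bound[where B=B])
    show "AE x in M. norm (f x) \<le> B"
      using support by (rule eventually_mono) (use B in auto)
  qed (simp add: borel_M f borel_measurable_continuous_onI)
qed

lemma continuous_slice:
  fixes F :: "real \<Rightarrow> real \<Rightarrow> real"
  assumes F: "continuous_on UNIV (\<lambda>(s, \<tau>). F s \<tau>)"
  shows "continuous_on A (\<lambda>\<tau>. F s \<tau>)" "continuous_on A (\<lambda>s. F s \<tau>)"
proof -
  have "continuous_on A (\<lambda>\<tau>. (s, \<tau>))" "continuous_on A (\<lambda>s. (s, \<tau>))"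
    by (intro continuous_intros)+
  from this[THEN continuous_on_compose2[OF F]]
  show "continuous_on A (\<lambda>\<tau>. F s \<tau>)" "continuous_on A (\<lambda>s. F s \<tau>)" by simp_all
qed

lemma compact_bound:
  fixes F :: "real \<Rightarrow> real \<Rightarrow> real"
  assumes F: "continuous_on UNIV (\<lambda>(s, \<tau>). F s \<tau>)"
  obtains B where "B \<ge> 0" "\<And>s \<tau>. s \<in> {a..b} \<Longrightarrow> \<tau> \<in> {-D..D} \<Longrightarrow> \<bar>F s \<tau>\<bar> \<le> B"
proof -
  have "compact ((\<lambda>(s, \<tau>). F s \<tau>) ` ({a..b} \<times> {-D..D}))"
    by (rule compact_continuous_image[OF continuous_on_subset[OF F]]) (auto intro: compact_Times)
  then obtain B where B: "\<forall>x \<in> {a..b} \<times> {-D..D}. \<bar>case x of (s, \<tau>) \<Rightarrow> F s \<tau>\<bar> \<le> B"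
    using compact_imp_bounded[of "(\<lambda>(s, \<tau>). F s \<tau>) ` ({a..b} \<times> {-D..D})"]
    unfolding bounded_iff real_norm_def by blast
  show ?thesis
  proof (rule that[of "max 0 B"])
    show "\<bar>F s \<tau>\<bar> \<le> max 0 B" if "s \<in> {a..b}" "\<tau> \<in> {-D..D}" for s \<tau>
      using B that by (force simp: le_max_iff_disj)
  qed simp
qed

lemma continuous_expectation:
  fixes F :: "real \<Rightarrow> real \<Rightarrow> real"
  assumes F: "continuous_on UNIV (\<lambda>(s, \<tau>). F s \<tau>)"
  shows "continuous_on A (\<lambda>s. \<integral>\<tau>. F s \<tau> \<partial>M)"
proof -
  have "isCont (\<lambda>s. \<integral>\<tau>. F s \<tau> \<partial>M) s" for s
    unfolding continuous_at_sequentially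
  proof (intro allI impI)
    fix X :: "nat \<Rightarrow> real" assume X: "X \<longlonglongrightarrow> s"
    obtain R where R: "\<And>n. \<bar>X n\<bar> \<le> R"
      using convergent_imp_Bseq[of X] X by (auto simp: convergent_def Bseq_def)
    obtain B where B: "\<And>s \<tau>. s \<in> {-R..R} \<Longrightarrow> \<tau> \<in> {-D..D} \<Longrightarrow> \<bar>F s \<tau>\<bar> \<le> B"
      using compact_bound[OF F] by metis
    have XR: "X n \<in> {-R..R}" for n using R[of n] by auto
    show "((\<lambda>s. \<integral>\<tau>. F s \<tau> \<partial>M) \<circ> X) \<longlonglongrightarrow> (\<integral>\<tau>. F s \<tau> \<partial>M)"
      unfolding o_def
    proof (rule integral_dominated_convergence[where w = "\<lambda>_. B"])
      show "AE \<tau> in M. (\<lambda>n. F (X n) \<tau>) \<longlonglongrightarrow> F s \<tau>"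
      proof (intro AE_I2)
        fix \<tau>
        have "isCont (\<lambda>s. F s \<tau>) s"
          using continuous_slice(2)[OF F, of UNIV \<tau>] by (simp add: continuous_on_eq_continuous_at)
        then show "(\<lambda>n. F (X n) \<tau>) \<longlonglongrightarrow> F s \<tau>"
          using X by (rule isCont_tendsto_compose)
      qed
      show "AE \<tau> in M. norm (F (X n) \<tau>) \<le> B" for n
        using support by (rule eventually_mono) (use B[OF XR[of n]] in simp)
    qed (auto simp: borel_M intro!: borel_measurable_continuous_onI continuous_slice[OF F])
  qed
  then show ?thesis by (simp add: continuous_at_imp_continuous_on)
qed

text \<open>Cut off outside the box \<open>{a..b} \<times> {-D..D}\<close>, \<open>F\<close> is
  bounded by compactness and hence integrable for the product measure. The cut-off in \<tau> changes
  nothing almost everywhere.\<close>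

lemma fubini_continuous:
  fixes F :: "real \<Rightarrow> real \<Rightarrow> real"
  assumes F: "continuous_on UNIV (\<lambda>(s, \<tau>). F s \<tau>)"
  shows "integrable M (\<lambda>\<tau>. integral {a..b} (\<lambda>s. F s \<tau>))"
    and "integral {a..b} (\<lambda>s. \<integral>\<tau>. F s \<tau> \<partial>M) = (\<integral>\<tau>. integral {a..b} (\<lambda>s. F s \<tau>) \<partial>M)"
proof -
  note sigma_finite_M = sigma_finite_measure_axioms
  interpret pair_sigma_finite lborel M
    by (intro pair_sigma_finite.intro sigma_finite_lborel sigma_finite_measure_axioms)
  obtain B where B: "B \<ge> 0" "\<And>s \<tau>. s \<in> {a..b} \<Longrightarrow> \<tau> \<in> {-D..D} \<Longrightarrow> \<bar>F s \<tau>\<bar> \<le> B"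
    using compact_bound[OF F] by metis
  define H where "H s \<tau> = indicator {a..b} s * (indicator {-D..D} \<tau> * F s \<tau>)" for s \<tau>
  have [measurable_cong]: "sets M = sets borel" by (rule sets_M)
  have mF: "(\<lambda>(s, \<tau>). F s \<tau>) \<in> borel_measurable (borel \<Otimes>\<^sub>M borel)"
    unfolding borel_prod by (rule borel_measurable_continuous_onI[OF F])
  have sets_prod: "sets (lborel \<Otimes>\<^sub>M M) = sets (borel \<Otimes>\<^sub>M borel)"
    by (intro sets_pair_measure_cong sets_M) simp
  have mF' [measurable]: "(\<lambda>(s, \<tau>). F s \<tau>) \<in> borel_measurable (lborel \<Otimes>\<^sub>M M)"
    using mF measurable_cong_sets[OF sets_prod refl] by blast
  have mH: "case_prod H \<in> borel_measurable (lborel \<Otimes>\<^sub>M M)"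
    unfolding H_def by measurable
  have int: "integrable (lborel \<Otimes>\<^sub>M M) (case_prod H)"
  proof (rule Bochner_Integration.integrable_bound[OF _ mH])
    have box: "{a..b} \<times> {-D..D} \<in> sets (lborel \<Otimes>\<^sub>M M)"
      unfolding sets_prod by (intro pair_measureI) auto
    have "emeasure (lborel \<Otimes>\<^sub>M M) ({a..b} \<times> {-D..D}) = emeasure lborel {a..b} * emeasure M {-D..D}"
      by (rule sigma_finite_measure.emeasure_pair_measure_Times[OF sigma_finite_M]) (auto simp: sets_M)
    also have "\<dots> < \<infinity>"
      by (simp add: ennreal_mult_less_top emeasure_eq_measure emeasure_lborel_Icc_eq)
    finally show "integrable (lborel \<Otimes>\<^sub>M M) (\<lambda>x. B * indicat_real ({a..b} \<times> {-D..D}) x)"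
      using box by (intro integrable_mult_right integrable_real_indicator) auto
    show "AE x in lborel \<Otimes>\<^sub>M M. norm (case_prod H x) \<le> norm (B * indicat_real ({a..b} \<times> {-D..D}) x)"
      using B by (intro AE_I2) (auto simp: H_def indicator_def split: prod.split)
  qed
  have inner: "(\<integral>s. H s \<tau> \<partial>lborel) = indicator {-D..D} \<tau> * integral {a..b} (\<lambda>s. F s \<tau>)" for \<tau>
  proof -
    have "set_integrable lborel {a..b} (\<lambda>s. F s \<tau>)"
      by (rule borel_integrable_atLeastAtMost') (rule continuous_slice[OF F])
    from set_borel_integral_eq_integral(2)[OF this]
    have "(\<integral>s. indicator {a..b} s * F s \<tau> \<partial>lborel) = integral {a..b} (\<lambda>s. F s \<tau>)"
      by (simp add: set_lebesgue_integral_def)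
    moreover have "H s \<tau> = indicator {-D..D} \<tau> * (indicator {a..b} s * F s \<tau>)" for s
      by (simp add: H_def)
    ultimately show ?thesis by simp
  qed
  have inner2: "(\<integral>\<tau>. H s \<tau> \<partial>M) = indicator {a..b} s * (\<integral>\<tau>. F s \<tau> \<partial>M)" for s
  proof -
    have m: "(\<lambda>\<tau>. F s \<tau>) \<in> borel_measurable M"
      unfolding borel_M by (intro borel_measurable_continuous_onI continuous_slice[OF F])
    have "AE \<tau> in M. indicator {-D..D} \<tau> * F s \<tau> = F s \<tau>"
      using support by (rule eventually_mono) simp
    then have "(\<integral>\<tau>. indicator {-D..D} \<tau> * F s \<tau> \<partial>M) = (\<integral>\<tau>. F s \<tau> \<partial>M)"
      using m by (intro integral_cong_AE) (auto simp: sets_M)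
    then show ?thesis by (simp add: H_def)
  qed
  have AE_in: "AE \<tau> in M. integral {a..b} (\<lambda>s. F s \<tau>) = (\<integral>s. H s \<tau> \<partial>lborel)"
    using support by (rule eventually_mono) (simp add: inner)
  have contI: "(\<lambda>\<tau>. integral {a..b} (\<lambda>s. F s \<tau>)) \<in> borel_measurable M"
  proof -
    have "continuous_on UNIV (\<lambda>\<tau>. integral (cbox a b) (\<lambda>s. F s \<tau>))"
    proof (rule integral_continuous_on_param)
      show "continuous_on (UNIV \<times> cbox a b) (\<lambda>(\<tau>, s). F s \<tau>)"
        using continuous_on_compose2[OF F continuous_on_swap[of "UNIV \<times> cbox a b"]]
        by (simp add: case_prod_unfold)
    qed
    then show ?thesis by (simp add: borel_M borel_measurable_continuous_onI)
  qed
  show "integrable M (\<lambda>\<tau>. integral {a..b} (\<lambda>s. F s \<tau>))"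
    using integrable_snd[OF int]
    by (subst integrable_cong_AE[OF contI _ AE_in]) (auto intro: borel_measurable_integrable)
  have "set_integrable lborel {a..b} (\<lambda>s. \<integral>\<tau>. F s \<tau> \<partial>M)"
    by (rule borel_integrable_atLeastAtMost') (rule continuous_expectation[OF F])
  from set_borel_integral_eq_integral(2)[OF this]
  have "integral {a..b} (\<lambda>s. \<integral>\<tau>. F s \<tau> \<partial>M) = (\<integral>s. \<integral>\<tau>. H s \<tau> \<partial>M \<partial>lborel)"
    by (simp add: set_lebesgue_integral_def inner2)
  also have "\<dots> = (\<integral>\<tau>. \<integral>s. H s \<tau> \<partial>lborel \<partial>M)"
    by (rule Fubini_integral[OF int, symmetric])
  also have "\<dots> = (\<integral>\<tau>. integral {a..b} (\<lambda>s. F s \<tau>) \<partial>M)"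
    using integrable_snd[OF int]
    by (intro integral_cong_AE[OF _ contI]) (use AE_in in \<open>auto intro: borel_measurable_integrable elim!: eventually_mono\<close>)
  finally show "integral {a..b} (\<lambda>s. \<integral>\<tau>. F s \<tau> \<partial>M) = (\<integral>\<tau>. integral {a..b} (\<lambda>s. F s \<tau>) \<partial>M)" .
qed

end

section \<open>The Gaussian test weight\<close>

text \<open>The left half of a Gaussian centred at \<open>Q\<close>, continued by its maximum 1.
  Being constant beyond \<open>Q\<close>, it has rate 0 there, so the right boundary term of an
  integration by parts involves no large rate.\<close>

definition gauss_weight :: "real \<Rightarrow> real \<Rightarrow> real \<Rightarrow> real" where
  "gauss_weight \<rho> Q s = exp (- (\<rho> / 2) * (max 0 (Q - s))\<^sup>2)"

lemma gauss_weight_pos: "gauss_weight \<rho> Q s > 0"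
  by (simp add: gauss_weight_def)

lemma continuous_gauss_weight [continuous_intros]:
  "continuous_on A f \<Longrightarrow> continuous_on A (\<lambda>x. gauss_weight \<rho> Q (f x))"
  unfolding gauss_weight_def by (intro continuous_intros)

lemma gauss_weight_mono:
  assumes "\<rho> \<ge> 0" "s \<le> t"
  shows "gauss_weight \<rho> Q s \<le> gauss_weight \<rho> Q t"
proof -
  have "(max 0 (Q - t))\<^sup>2 \<le> (max 0 (Q - s))\<^sup>2" using assms by (intro power_mono) auto
  then show ?thesis using assms unfolding gauss_weight_def by (simp add: mult_left_mono)
qed

lemma gauss_weight_eq_1: "s \<ge> Q \<Longrightarrow> gauss_weight \<rho> Q s = 1"
  by (simp add: gauss_weight_def)

text \<open>Compares the weight with the exponential at its local rate. With p = max 0 (Q - s),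
  expanding (p - \<tau>)^2 gives the exponential, and the remaining \<tau>^2 \<le> D^2 costs only a
  constant factor, close to 1 for small \<rho>.\<close>

lemma gauss_weight_shift:
  assumes \<rho>: "\<rho> \<ge> 0" and \<tau>: "\<bar>\<tau>\<bar> \<le> D"
  shows "gauss_weight \<rho> Q (s + \<tau>) \<ge>
    gauss_weight \<rho> Q s * exp (- (\<rho> / 2) * D\<^sup>2) * exp (\<rho> * max 0 (Q - s) * \<tau>)"
proof -
  let ?p = "max 0 (Q - s)"
  have "(max 0 (Q - (s + \<tau>)))\<^sup>2 \<le> (?p - \<tau>)\<^sup>2"
  proof (cases "Q - s \<ge> 0")
    case True
    then show ?thesis by (auto simp: max_def algebra_simps)
  next
    case False
    then have "max 0 (Q - (s + \<tau>)) \<le> \<bar>\<tau>\<bar>" "?p = 0" by auto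
    then show ?thesis using power_mono[of "max 0 (Q - (s + \<tau>))" "\<bar>\<tau>\<bar>" 2] by simp
  qed
  also have "\<dots> \<le> ?p\<^sup>2 + D\<^sup>2 - 2 * ?p * \<tau>"
    using power_mono[OF \<tau>, of 2] by (simp add: power2_diff)
  finally have "- (\<rho> / 2) * (max 0 (Q - (s + \<tau>)))\<^sup>2 \<ge> - (\<rho> / 2) * (?p\<^sup>2 + D\<^sup>2 - 2 * ?p * \<tau>)"
    using \<rho> by (intro mult_left_mono_neg) auto
  then show ?thesis
    unfolding gauss_weight_def exp_add[symmetric] by (simp add: algebra_simps)
qed

section \<open>Exponential moments and vanishing convolutions\<close>

context compact_law
begin

text \<open>Markov's inequality for the exponential; for \<open>a > 0\<close> and positive mass of
  \<open>{a..}\<close> it makes the moment grow exponentially in \<open>x\<close>.\<close>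

lemma exp_moment_lower:
  assumes "x \<ge> 0"
  shows "measure M {a..} * exp (x * a) \<le> (\<integral>\<tau>. exp (x * \<tau>) \<partial>M)"
proof -
  have "measure M {a..} * exp (x * a) = (\<integral>\<tau>. indicator {a..} \<tau> * exp (x * a) \<partial>M)"
    by (simp add: sets_M space_M)
  also have "\<dots> \<le> (\<integral>\<tau>. exp (x * \<tau>) \<partial>M)"
  proof (rule integral_mono)
    show "integrable M (\<lambda>\<tau>. indicator {a..} \<tau> * exp (x * a))"
      by (intro integrable_mult_left integrable_real_indicator)
         (auto simp: sets_M emeasure_eq_measure)
    show "integrable M (\<lambda>\<tau>. exp (x * \<tau>))"
      by (intro integrable_continuous continuous_intros)
    show "indicator {a..} \<tau> * exp (x * a) \<le> exp (x * \<tau>)" for \<tau>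
      using assms by (auto simp: indicator_def mult_left_mono)
  qed
  finally show ?thesis .
qed

lemma expectation_mono:
  fixes f g :: "real \<Rightarrow> real"
  assumes "continuous_on UNIV f" "continuous_on UNIV g" "\<And>\<tau>. \<bar>\<tau>\<bar> \<le> D \<Longrightarrow> f \<tau> \<le> g \<tau>"
  shows "(\<integral>\<tau>. f \<tau> \<partial>M) \<le> (\<integral>\<tau>. g \<tau> \<partial>M)"
proof (rule integral_mono_AE)
  show "AE \<tau> in M. f \<tau> \<le> g \<tau>"
    using support by (rule eventually_mono) (use assms(3) in auto)
qed (intro integrable_continuous assms)+

text \<open>Multiply the convolution by exp (l s) and integrate over \<open>{T..T+D}\<close>. Up to
  an error of order exp (l T) the result is the moment \<open>?k\<close> times the Laplace integral
  \<open>J\<close> of \<open>f\<close> over \<open>{T-D..T}\<close>. Since \<open>?k\<close> grows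
  at least like exp (l a), \<open>J\<close> is of order exp (l (T - a)); thus the moments of
  \<open>f\<close> on \<open>{T-a..T}\<close>, normalised at \<open>T - a\<close>, stay bounded in
  l.\<close>

lemma convolution_vanishing:
  fixes f :: "real \<Rightarrow> real"
  assumes f: "continuous_on UNIV f"
    and zero: "\<And>s. s \<ge> T \<Longrightarrow> f s = 0"
    and conv: "\<And>s. s \<ge> T \<Longrightarrow> (\<integral>\<tau>. f (s - \<tau>) \<partial>M) = 0"
    and a: "0 < a" "a \<le> D" "measure M {a..} > 0"
    and r: "r \<in> {T - a<..<T}"
  shows "f r = 0"
proof -
  have cf [continuous_intros]: "continuous_on A (\<lambda>x. f (w x))" if "continuous_on A w" for A and w :: "'a::topological_space \<Rightarrow> real"
    by (rule continuous_on_compose2[OF f that]) auto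
  have "compact (f ` {T-D..T})"
    by (rule compact_continuous_image[OF continuous_on_subset[OF f]]) auto
  then obtain C0 where C0: "\<And>x. x \<in> {T-D..T} \<Longrightarrow> \<bar>f x\<bar> \<le> C0"
    using compact_imp_bounded[of "f ` {T-D..T}"] unfolding bounded_iff real_norm_def by blast
  define C where "C = max 0 C0"
  have C: "\<bar>f x\<bar> \<le> C" if "x \<ge> T - D" for x
    using C0[of x] zero[of x] that by (cases "x \<le> T") (auto simp: C_def)
  have "C \<ge> 0" by (simp add: C_def)
  let ?\<mu> = "measure M {a..}"
  have main: "\<bar>integral {T-a..T} (\<lambda>r. exp (real n * (r - (T-a))) * f r)\<bar> \<le> 2 * D * C / ?\<mu> + D * C" for n :: nat
  proof -
    define l where "l = real n"
    have l: "l \<ge> 0" by (simp add: l_def)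
    define J where "J = integral {T-D..T} (\<lambda>r. exp (l * r) * f r)"
    let ?k = "\<integral>\<tau>. exp (l * \<tau>) \<partial>M"
    let ?w = "\<lambda>s \<tau>. exp (l * s) * f (s - \<tau>)"
    have cw: "continuous_on UNIV (\<lambda>(s, \<tau>). ?w s \<tau>)"
      unfolding case_prod_unfold by (intro continuous_intros)
    have wint: "(\<lambda>s. ?w s \<tau>) integrable_on {x..y}" for x y \<tau>
      by (intro integrable_continuous_real continuous_intros)
    \<comment> \<open>After the shift by \<tau> the two integrals differ only on
      \<open>{T-D+\<tau>..T}\<close>, of length at most 2 D, where the exponential is at most exp (l
      T).\<close>
    have diff: "\<bar>exp (l * \<tau>) * J - integral {T..T+D} (\<lambda>s. ?w s \<tau>)\<bar> \<le> exp (l * T) * (2 * D * C)"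
      if \<tau>: "\<bar>\<tau>\<bar> \<le> D" for \<tau>
    proof -
      have "exp (l * \<tau>) * J = integral {T-D..T} ((\<lambda>s. ?w s \<tau>) \<circ> (\<lambda>r. r + \<tau>))"
        unfolding J_def integral_mult_right[symmetric] by (simp add: o_def exp_add algebra_simps)
      also have "\<dots> = integral {T-D+\<tau>..T+\<tau>} (\<lambda>s. ?w s \<tau>)"
        by (rule integral_shift) (intro continuous_intros)
      also have "\<dots> = integral {T-D+\<tau>..T+D} (\<lambda>s. ?w s \<tau>)" \<comment> \<open>the integrand vanishes beyond \<open>T + \<tau>\<close>\<close>
      proof -
        have "integral {T+\<tau>..T+D} (\<lambda>s. ?w s \<tau>) = integral {T+\<tau>..T+D} (\<lambda>_. 0)"
          by (rule Henstock_Kurzweil_Integration.integral_cong) (simp add: zero)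
        then show ?thesis
          using Henstock_Kurzweil_Integration.integral_combine[OF _ _ wint, of "T-D+\<tau>" "T+\<tau>" "T+D" \<tau>] \<tau> a by simp
      qed
      also have "\<dots> = integral {T-D+\<tau>..T} (\<lambda>s. ?w s \<tau>) + integral {T..T+D} (\<lambda>s. ?w s \<tau>)"
        using Henstock_Kurzweil_Integration.integral_combine[OF _ _ wint, of "T-D+\<tau>" "T" "T+D" \<tau>] \<tau> a by simp
      finally have "\<bar>exp (l * \<tau>) * J - integral {T..T+D} (\<lambda>s. ?w s \<tau>)\<bar> = norm (integral {T-D+\<tau>..T} (\<lambda>s. ?w s \<tau>))"
        by simp
      also have "\<dots> \<le> exp (l * T) * C * (T - (T - D + \<tau>))"
      proof (rule integral_bound)
        show "T - D + \<tau> \<le> T" using \<tau> by simp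
        show "norm (?w s \<tau>) \<le> exp (l * T) * C" if "s \<in> {T-D+\<tau>..T}" for s
          unfolding norm_mult using that l by (intro mult_mono) (auto intro!: C mult_left_mono)
      qed (intro continuous_intros)
      also have "\<dots> \<le> exp (l * T) * C * (2 * D)"
        using \<tau> \<open>C \<ge> 0\<close> by (intro mult_left_mono) auto
      finally show ?thesis by (simp add: mult_ac)
    qed
    have I1: "integrable M (\<lambda>\<tau>. exp (l * \<tau>))"
      by (intro integrable_continuous continuous_intros)
    have "(\<integral>\<tau>. integral {T..T+D} (\<lambda>s. ?w s \<tau>) \<partial>M) = integral {T..T+D} (\<lambda>s. \<integral>\<tau>. ?w s \<tau> \<partial>M)"
      by (rule fubini_continuous(2)[OF cw, symmetric])
    also have "\<dots> = integral {T..T+D} (\<lambda>_. 0)"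
      by (rule Henstock_Kurzweil_Integration.integral_cong) (simp add: conv)
    \<comment> \<open>The subtracted double integral is 0 by \<open>conv\<close>, so the product
      \<open>?k * J\<close> becomes the average of the errors estimated in
      \<open>diff\<close>.\<close>
    finally have eq: "?k * J = (\<integral>\<tau>. exp (l * \<tau>) * J - integral {T..T+D} (\<lambda>s. ?w s \<tau>) \<partial>M)"
      using I1 fubini_continuous(1)[OF cw] by simp
    have "\<bar>?k * J\<bar> \<le> (\<integral>\<tau>. \<bar>exp (l * \<tau>) * J - integral {T..T+D} (\<lambda>s. ?w s \<tau>)\<bar> \<partial>M)"
      unfolding eq by (rule integral_abs_bound)
    also have "\<dots> \<le> (\<integral>\<tau>. exp (l * T) * (2 * D * C) \<partial>M)"
    proof (rule integral_mono_AE)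
      show "AE \<tau> in M. \<bar>exp (l * \<tau>) * J - integral {T..T+D} (\<lambda>s. ?w s \<tau>)\<bar> \<le> exp (l * T) * (2 * D * C)"
      proof (rule eventually_mono[OF support])
        show "\<bar>exp (l * \<tau>) * J - integral {T..T+D} (\<lambda>s. ?w s \<tau>)\<bar> \<le> exp (l * T) * (2 * D * C)"
          if "\<tau> \<in> {-D..D}" for \<tau>
          by (rule diff) (use that in auto)
      qed
      show "integrable M (\<lambda>\<tau>. \<bar>exp (l * \<tau>) * J - integral {T..T+D} (\<lambda>s. ?w s \<tau>)\<bar>)"
        by (intro integrable_abs Bochner_Integration.integrable_diff integrable_mult_left I1 fubini_continuous(1)[OF cw])
    qed simp
    also have "\<dots> = exp (l * T) * (2 * D * C)" by (simp add: prob_space)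
    finally have kJ: "\<bar>?k * J\<bar> \<le> exp (l * T) * (2 * D * C)" .
    have "?\<mu> * exp (l * a) * \<bar>J\<bar> \<le> ?k * \<bar>J\<bar>"
      by (intro mult_right_mono exp_moment_lower l) auto
    also have "\<dots> \<le> \<bar>?k * J\<bar>" by (simp add: abs_mult mult_right_mono)
    also note kJ
    also have "exp (l * T) = exp (l * a) * exp (l * (T - a))"
      unfolding exp_add[symmetric] by (simp add: algebra_simps)
    finally have "exp (l * a) * (?\<mu> * \<bar>J\<bar>) \<le> exp (l * a) * (exp (l * (T - a)) * (2 * D * C))"
      by (simp add: mult_ac)
    then have J: "\<bar>J\<bar> \<le> exp (l * (T - a)) * (2 * D * C / ?\<mu>)"
      using a by (simp add: field_simps)
    have Jint: "(\<lambda>r. exp (l * r) * f r) integrable_on {x..y}" for x y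
      by (intro integrable_continuous_real continuous_intros)
    \<comment> \<open>On the stretch below \<open>T - a\<close> the exponential is at most exp (l (T
      - a)), the same order as the bound on \<open>J\<close>, so this stretch can be split
      off.\<close>
    have J2: "norm (integral {T-D..T-a} (\<lambda>r. exp (l * r) * f r)) \<le> exp (l * (T - a)) * C * ((T - a) - (T - D))"
    proof (rule integral_bound)
      show "norm (exp (l * s) * f s) \<le> exp (l * (T-a)) * C" if "s \<in> {T-D..T-a}" for s
        unfolding norm_mult using that l by (intro mult_mono) (auto intro!: C mult_left_mono)
    qed (use a in \<open>auto intro!: continuous_intros\<close>)
    also have "\<dots> \<le> exp (l * (T - a)) * C * D"
      using a \<open>C \<ge> 0\<close> by (intro mult_left_mono) auto
    finally have J2: "\<bar>integral {T-D..T-a} (\<lambda>r. exp (l * r) * f r)\<bar> \<le> exp (l * (T - a)) * (D * C)"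
      by (simp add: mult_ac)
    have "integral {T-a..T} (\<lambda>r. exp (l * (r - (T-a))) * f r)
        = exp (- (l * (T - a))) * integral {T-a..T} (\<lambda>r. exp (l * r) * f r)"
      unfolding integral_mult_right[symmetric] mult.assoc[symmetric] exp_add[symmetric]
      by (simp add: algebra_simps)
    also have "integral {T-a..T} (\<lambda>r. exp (l * r) * f r) = J - integral {T-D..T-a} (\<lambda>r. exp (l * r) * f r)"
      using Henstock_Kurzweil_Integration.integral_combine[OF _ _ Jint, of "T-D" "T-a" "T"] a
      by (simp add: J_def)
    also have "\<bar>exp (- (l * (T - a))) * \<dots>\<bar> \<le> exp (- (l * (T - a))) * (exp (l * (T - a)) * (2 * D * C / ?\<mu>) + exp (l * (T - a)) * (D * C))"
      unfolding abs_mult using J J2 by (intro mult_mono) auto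
    also have "\<dots> = 2 * D * C / ?\<mu> + D * C"
      unfolding distrib_left mult.assoc[symmetric] exp_add[symmetric] by simp
    finally show ?thesis by (simp add: l_def)
  qed
  show ?thesis
    by (rule mikusinski_vanishing[OF continuous_on_subset[OF f] main r]) auto
qed

section \<open>The Gaussian-weighted integral estimate\<close>

text \<open>Test \<open>ineq\<close> against the weight on \<open>{S..b}\<close>. Integration by
  parts moves the derivatives, and Fubini the delay, onto the weight;
  \<open>gauss_weight_shift\<close> then produces \<open>k\<close> at the local rate, where
  \<open>gap\<close> applies pointwise. What remains are boundary terms at \<open>b\<close> and near
  \<open>S\<close>, the latter weighted by at most the value at \<open>S + D\<close>.\<close>

lemma weighted_estimate:
  fixes y y' y'' :: "real \<Rightarrow> real"
  defines "k \<equiv> \<lambda>x. \<integral>\<tau>. exp (x * \<tau>) \<partial>M"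
  assumes dy: "\<And>s. (y has_real_derivative y' s) (at s)"
    and dy': "\<And>s. (y' has_real_derivative y'' s) (at s)"
    and cy'': "continuous_on UNIV y''"
    and nonneg: "\<And>s. s \<ge> S - D \<Longrightarrow> y s \<ge> 0"
    and le1: "\<And>s. s \<ge> S \<Longrightarrow> y s \<le> 1"
    and ineq: "\<And>s. s \<ge> S \<Longrightarrow> y'' s - c * y' s - y s \<ge> q * (\<integral>\<tau>. y (s - \<tau>) \<partial>M)"
    and gap: "\<And>x. x \<ge> 0 \<Longrightarrow> x\<^sup>2 + c * x - 1 - q * exp (- (\<rho> / 2) * D\<^sup>2) * k x \<le> - \<delta>"
    and pos: "D > 0" "c > 0" "q > 0" "\<rho> > 0" "\<delta> > 0"
    and Q: "Q \<ge> S + D" and b: "b \<ge> Q + D"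
    and st: "S + D \<le> s0" "s0 \<le> s1" "s1 \<le> b - D"
  shows "\<delta> * gauss_weight \<rho> Q s0 * integral {s0..s1} y \<le>
     y' b + gauss_weight \<rho> Q (S + D) *
       (\<bar>y' S\<bar> + \<rho> * (Q - S) + c + D * ((\<rho> * (Q - S))\<^sup>2 + c * (\<rho> * (Q - S))))"
proof -
  define m where "m = gauss_weight \<rho> Q"
  define x where "x s = \<rho> * max 0 (Q - s)" for s
  define Y where "Y s = (\<integral>\<tau>. y (s - \<tau>) \<partial>M)" for s
  define B where "B s = m s * y' s - x s * m s * y s - c * m s * y s" for s
  define B' where "B' s = m s * (y'' s - c * y' s)
     - ((if s < Q then (x s)\<^sup>2 - \<rho> else 0) + c * x s) * m s * y s" for s
  define X where "X = \<rho> * (Q - S)"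
  have cy: "continuous_on UNIV y" and cy': "continuous_on UNIV y'"
    using dy dy' by (auto intro!: DERIV_continuous_on continuous_at_imp_continuous_on DERIV_isCont)
  have [continuous_intros]:
      "continuous_on A (\<lambda>z. y (w z))" "continuous_on A (\<lambda>z. y' (w z))" "continuous_on A (\<lambda>z. y'' (w z))"
      "continuous_on A (\<lambda>z. m (w z))" "continuous_on A (\<lambda>z. x (w z))"
    if "continuous_on A w" for A and w :: "'a::topological_space \<Rightarrow> real"
    unfolding m_def x_def
    by (auto intro!: continuous_intros that continuous_on_compose2[OF cy that]
        continuous_on_compose2[OF cy' that] continuous_on_compose2[OF cy'' that])
  have cY: "continuous_on A Y" for A
    unfolding Y_def by (rule continuous_expectation) (auto simp: case_prod_unfold intro!: continuous_intros)
  have ck: "continuous_on A k" for A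
    unfolding k_def by (rule continuous_expectation) (auto simp: case_prod_unfold intro!: continuous_intros)
  have [continuous_intros]: "continuous_on A (\<lambda>z. Y (w z))" "continuous_on A (\<lambda>z. k (w z))"
    if "continuous_on A w" for A and w :: "'a::topological_space \<Rightarrow> real"
    using continuous_on_compose2[OF cY that] continuous_on_compose2[OF ck that] by auto
  have m_pos: "m s > 0" for s by (simp add: m_def gauss_weight_pos)
  have m_mono: "s \<le> t \<Longrightarrow> m s \<le> m t" for s t using pos by (simp add: m_def gauss_weight_mono)
  have x0: "x s \<ge> 0" for s using pos by (simp add: x_def)

  \<comment> \<open>\<open>B\<close> is the boundary term of the integration by parts of \<open>m (y'' - c y')\<close>; its derivative jumps at
    \<open>Q\<close>, where \<open>m''\<close> does.\<close>
  have dB: "(B has_real_derivative B' s) (at s)" if "s \<noteq> Q" for s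
  proof (cases "s < Q")
    case True
    define e where "e s = exp (- (\<rho> / 2) * (Q - s)\<^sup>2)" for s
    have eqs: "m t = e t" "x t = \<rho> * (Q - t)" if "t < Q" for t
      using that by (auto simp: m_def e_def x_def gauss_weight_def)
    have de: "(e has_real_derivative e s * (\<rho> * (Q - s))) (at s)"
      unfolding e_def by (auto intro!: derivative_eq_intros simp: field_simps)
    have dl: "((\<lambda>s. \<rho> * (Q - s)) has_real_derivative - \<rho>) (at s)"
      by (auto intro!: derivative_eq_intros)
    have "((\<lambda>s. e s * y' s - \<rho> * (Q - s) * e s * y s - c * e s * y s) has_real_derivative B' s) (at s)"
      by (rule DERIV_cong[OF DERIV_diff[OF DERIV_diff[OF DERIV_mult[OF de dy']
            DERIV_mult[OF DERIV_mult[OF dl de] dy]] DERIV_mult[OF DERIV_cmult[OF de] dy]]])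
         (use True in \<open>simp add: B'_def eqs algebra_simps power2_eq_square\<close>)
    then show ?thesis
      by (rule has_field_derivative_transform_within_open[of _ _ _ "{..<Q}"])
         (use True in \<open>auto simp: B_def eqs\<close>)
  next
    case False
    with that have "s > Q" by simp
    have eqs: "m t = 1" "x t = 0" if "t > Q" for t
      using that by (auto simp: m_def x_def gauss_weight_def)
    have "((\<lambda>s. y' s - c * y s) has_real_derivative B' s) (at s)"
      by (rule DERIV_cong[OF DERIV_diff[OF dy' DERIV_cmult[OF dy]]])
         (use \<open>s > Q\<close> in \<open>simp add: B'_def eqs\<close>)
    then show ?thesis
      by (rule has_field_derivative_transform_within_open[of _ _ _ "{Q<..}"])
         (use \<open>s > Q\<close> in \<open>auto simp: B_def eqs\<close>)
  qed
  have "S \<le> b" using Q b pos by simp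
  have intB: "(B' has_integral (B b - B S)) {S..b}"
  proof (rule fundamental_theorem_of_calculus_interior_strong[of "{Q}"])
    show "continuous_on {S..b} B" unfolding B_def by (intro continuous_intros)
    show "(B has_vector_derivative B' s) (at s)" if "s \<in> {S<..<b} - {Q}" for s
      using dB[of s] that by (simp add: has_real_derivative_iff_has_vector_derivative)
  qed (use \<open>S \<le> b\<close> in auto)
  let ?F = "\<lambda>s. ((x s)\<^sup>2 + c * x s - 1) * m s * y s"
  have int: "f integrable_on {u..v}" if "continuous_on {u..v} f" for f :: "real \<Rightarrow> real" and u v
    using that by (rule integrable_continuous_real)
  \<comment> \<open>Left of \<open>Q\<close> the second derivative of \<open>m\<close> is
    \<open>((x s)\<^sup>2 - \<rho>) * m s\<close>. Dropping the \<rho> goes in the right direction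
    because \<open>y\<close> is nonnegative, and it removes the jump at \<open>Q\<close>, where
    \<open>x\<close> vanishes.\<close>
  have "integral {S..b} (\<lambda>s. q * (m s * Y s) - ?F s) \<le> B b - B S"
  proof (rule has_integral_le[OF integrable_integral intB])
    show "(\<lambda>s. q * (m s * Y s) - ?F s) integrable_on {S..b}"
      by (intro int continuous_intros)
    fix s assume s: "s \<in> {S..b}"
    then have "y s \<ge> 0" using nonneg pos by auto
    have "q * (m s * Y s) - ?F s = m s * (q * Y s + y s) - ((x s)\<^sup>2 + c * x s) * (m s * y s)"
      by (simp add: algebra_simps)
    also have "\<dots> \<le> m s * (y'' s - c * y' s) - ((if s < Q then (x s)\<^sup>2 - \<rho> else 0) + c * x s) * (m s * y s)"
      using ineq[of s] s m_pos[of s] \<open>y s \<ge> 0\<close> pos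
      by (intro diff_mono mult_left_mono mult_right_mono) (auto simp: Y_def x_def)
    finally show "q * (m s * Y s) - ?F s \<le> B' s" by (simp add: B'_def mult_ac)
  qed
  then have A1: "q * integral {S..b} (\<lambda>s. m s * Y s) \<le> B b - B S + integral {S..b} ?F"
    by (subst (asm) Henstock_Kurzweil_Integration.integral_diff) (auto intro!: int continuous_intros)

  let ?e = "exp (- (\<rho> / 2) * D\<^sup>2)"
  \<comment> \<open>Substitute s = r + \<tau>. For r in \<open>{S+D..b-D}\<close> every such s lies
    in \<open>{S..b}\<close>, and what is left out is nonnegative since \<open>y\<close> is so from
    \<open>S - D\<close> on.\<close>
  have A2: "?e * integral {S+D..b-D} (\<lambda>r. m r * y r * k (x r)) \<le> integral {S..b} (\<lambda>s. m s * Y s)"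
  proof -
    have "?e * integral {S+D..b-D} (\<lambda>r. m r * y r * k (x r)) = integral {S+D..b-D} (\<lambda>r. ?e * (m r * y r * k (x r)))"
      by simp
    also have "\<dots> \<le> integral {S+D..b-D} (\<lambda>r. \<integral>\<tau>. y r * m (r + \<tau>) \<partial>M)"
    proof (rule integral_le)
      show "(\<lambda>r. \<integral>\<tau>. y r * m (r + \<tau>) \<partial>M) integrable_on {S+D..b-D}"
        by (intro int continuous_expectation) (auto simp: case_prod_unfold intro!: continuous_intros)
      fix r assume r: "r \<in> {S+D..b-D}"
      then have "y r \<ge> 0" using nonneg pos by auto
      have "?e * (m r * y r * k (x r)) = (\<integral>\<tau>. y r * (m r * ?e * exp (x r * \<tau>)) \<partial>M)"
        by (simp add: k_def)
      also have "\<dots> \<le> (\<integral>\<tau>. y r * m (r + \<tau>) \<partial>M)"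
        unfolding m_def x_def using \<open>y r \<ge> 0\<close> pos
        by (intro expectation_mono mult_left_mono gauss_weight_shift continuous_intros) auto
      finally show "?e * (m r * y r * k (x r)) \<le> (\<integral>\<tau>. y r * m (r + \<tau>) \<partial>M)" .
    qed (intro int continuous_intros)
    also have "\<dots> = (\<integral>\<tau>. integral {S+D..b-D} (\<lambda>r. y r * m (r + \<tau>)) \<partial>M)"
      by (rule fubini_continuous(2)) (auto simp: case_prod_unfold intro!: continuous_intros)
    also have "\<dots> \<le> (\<integral>\<tau>. integral {S..b} (\<lambda>s. m s * y (s - \<tau>)) \<partial>M)"
    proof (rule integral_mono_AE)
      have "integral {S+D..b-D} (\<lambda>r. y r * m (r + \<tau>)) \<le> integral {S..b} (\<lambda>s. m s * y (s - \<tau>))"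
        if \<tau>: "\<tau> \<in> {-D..D}" for \<tau>
      proof -
        have "integral {S+D..b-D} (\<lambda>r. y r * m (r + \<tau>)) = integral {S+D..b-D} ((\<lambda>s. m s * y (s - \<tau>)) \<circ> (\<lambda>r. r + \<tau>))"
          by (simp add: o_def mult.commute)
        also have "\<dots> = integral {S+D+\<tau>..b-D+\<tau>} (\<lambda>s. m s * y (s - \<tau>))"
          by (rule integral_shift) (intro continuous_intros)
        also have "\<dots> \<le> integral {S..b} (\<lambda>s. m s * y (s - \<tau>))"
        proof (rule integral_subset_le)
          show "{S+D+\<tau>..b-D+\<tau>} \<subseteq> {S..b}" using \<tau> by auto
          show "\<forall>s\<in>{S..b}. 0 \<le> m s * y (s - \<tau>)"
            using \<tau> m_pos nonneg by (auto intro!: mult_nonneg_nonneg less_imp_le[OF m_pos])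
        qed (intro int continuous_intros)+
        finally show ?thesis .
      qed
      then show "AE \<tau> in M. integral {S+D..b-D} (\<lambda>r. y r * m (r + \<tau>)) \<le> integral {S..b} (\<lambda>s. m s * y (s - \<tau>))"
        using support by (auto elim: eventually_mono)
    qed (rule fubini_continuous(1), auto simp: case_prod_unfold intro!: continuous_intros)+
    also have "\<dots> = integral {S..b} (\<lambda>s. \<integral>\<tau>. m s * y (s - \<tau>) \<partial>M)"
      by (rule fubini_continuous(2)[symmetric]) (auto simp: case_prod_unfold intro!: continuous_intros)
    also have "\<dots> = integral {S..b} (\<lambda>s. m s * Y s)" by (simp add: Y_def)
    finally show ?thesis .
  qed

  have Fint: "?F integrable_on {u..v}" for u v by (intro int continuous_intros)
  have split: "integral {S..b} ?F = integral {S..S+D} ?F + integral {S+D..b-D} ?F + integral {b-D..b} ?F"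
    using Henstock_Kurzweil_Integration.integral_combine[OF _ _ Fint, of S "S+D" b]
      Henstock_Kurzweil_Integration.integral_combine[OF _ _ Fint, of "S+D" "b-D" b] Q b pos st by simp
  \<comment> \<open>Beyond \<open>Q\<close> the rate is 0 and the weight 1, so \<open>?F\<close> is
    just - y.\<close>
  have F_right: "integral {b-D..b} ?F \<le> 0"
  proof (rule has_integral_le[OF integrable_integral[OF Fint] has_integral_0])
    fix s assume "s \<in> {b-D..b}"
    then have "s \<ge> Q" "y s \<ge> 0" using b Q pos nonneg by auto
    then show "?F s \<le> 0" by (simp add: x_def m_def gauss_weight_eq_1)
  qed
  have X0: "X \<ge> 0" using Q pos by (simp add: X_def)
  \<comment> \<open>\<open>A2\<close> gives no compensation on this stretch, so the term is bounded
    crudely: \<open>y\<close> by 1, the rate by its value \<open>X\<close> at \<open>S\<close>, the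
    weight by its value at \<open>S + D\<close>.\<close>
  have F_left: "integral {S..S+D} ?F \<le> D * (X\<^sup>2 + c * X) * m (S + D)"
  proof -
    have "integral {S..S+D} ?F \<le> integral {S..S+D} (\<lambda>_. (X\<^sup>2 + c * X) * m (S + D))"
    proof (rule integral_le[OF Fint])
      fix s assume s: "s \<in> {S..S+D}"
      have xX: "x s \<le> X" using s pos Q by (auto simp: x_def X_def)
      have y: "0 \<le> y s" "y s \<le> 1" using s nonneg le1 pos by auto
      have "?F s \<le> ((x s)\<^sup>2 + c * x s) * (m s * y s)"
        using y m_pos[of s] by (simp add: algebra_simps)
      also have "\<dots> \<le> (X\<^sup>2 + c * X) * (m (S + D) * 1)"
        using xX x0[of s] y m_pos[of s] m_mono[of s "S + D"] s pos X0
        by (intro mult_mono add_mono power_mono) auto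
      finally show "?F s \<le> (X\<^sup>2 + c * X) * m (S + D)" by simp
    qed auto
    then show ?thesis using pos by (simp add: mult_ac)
  qed
  have middle: "\<delta> * integral {S+D..b-D} (\<lambda>r. m r * y r) \<le>
      q * (?e * integral {S+D..b-D} (\<lambda>r. m r * y r * k (x r))) - integral {S+D..b-D} ?F"
  proof -
    have "integral {S+D..b-D} (\<lambda>r. \<delta> * (m r * y r)) \<le>
       integral {S+D..b-D} (\<lambda>r. q * ?e * (m r * y r * k (x r)) - ?F r)"
    proof (rule integral_le)
      fix r assume r: "r \<in> {S+D..b-D}"
      then have "0 \<le> m r * y r" using nonneg pos m_pos[of r] by auto
      from mult_right_mono[OF gap[OF x0[of r]] this]
      show "\<delta> * (m r * y r) \<le> q * ?e * (m r * y r * k (x r)) - ?F r"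
        by (simp add: algebra_simps)
    qed (intro int continuous_intros)+
    also have "\<dots> = q * ?e * integral {S+D..b-D} (\<lambda>r. m r * y r * k (x r)) - integral {S+D..b-D} ?F"
      by (subst Henstock_Kurzweil_Integration.integral_diff) (auto intro!: int continuous_intros)
    finally show ?thesis by (simp add: mult.assoc)
  qed
  have Bb: "B b \<le> y' b"
    using b pos nonneg[of b] Q by (simp add: B_def x_def m_def gauss_weight_eq_1)
  have BS: "- B S \<le> m (S + D) * (\<bar>y' S\<bar> + X + c)"
  proof -
    have y: "0 \<le> y S" "y S \<le> 1" using nonneg le1 pos by auto
    have "- B S = m S * (- y' S + X * y S + c * y S)"
      using Q pos by (simp add: B_def x_def X_def algebra_simps)
    also have "\<dots> \<le> m S * (\<bar>y' S\<bar> + X * 1 + c * 1)"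
      using m_pos[of S] y X0 pos by (intro mult_left_mono add_mono) auto
    also have "\<dots> \<le> m (S + D) * (\<bar>y' S\<bar> + X * 1 + c * 1)"
      using m_mono[of S "S + D"] X0 pos by (intro mult_right_mono) auto
    finally show ?thesis by simp
  qed
  have low: "m s0 * integral {s0..s1} y \<le> integral {S+D..b-D} (\<lambda>r. m r * y r)"
  proof -
    have "m s0 * integral {s0..s1} y = integral {s0..s1} (\<lambda>r. m s0 * y r)" by simp
    also have "\<dots> \<le> integral {s0..s1} (\<lambda>r. m r * y r)"
      using m_mono nonneg st pos
      by (intro integral_le int continuous_intros mult_right_mono) auto
    also have "\<dots> \<le> integral {S+D..b-D} (\<lambda>r. m r * y r)"
    proof (rule integral_subset_le)
      show "\<forall>r\<in>{S+D..b-D}. 0 \<le> m r * y r"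
        using nonneg pos by (auto intro!: mult_nonneg_nonneg less_imp_le[OF m_pos])
    qed (use st in \<open>auto intro!: int continuous_intros\<close>)
    finally show ?thesis .
  qed
  have "\<delta> * (m s0 * integral {s0..s1} y) \<le> \<delta> * integral {S+D..b-D} (\<lambda>r. m r * y r)"
    using low pos by (intro mult_left_mono) auto
  also note middle
  also have "q * (?e * integral {S+D..b-D} (\<lambda>r. m r * y r * k (x r))) \<le> q * integral {S..b} (\<lambda>s. m s * Y s)"
    using A2 pos by (intro mult_left_mono) auto
  finally have "\<delta> * (m s0 * integral {s0..s1} y) \<le> B b - B S + integral {S..S+D} ?F + integral {b-D..b} ?F"
    using A1 split by simp
  also have "\<dots> \<le> y' b + m (S + D) * (\<bar>y' S\<bar> + X + c) + D * (X\<^sup>2 + c * X) * m (S + D)"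
    using Bb BS F_left F_right by simp
  finally show ?thesis
    unfolding m_def X_def by (simp add: algebra_simps)
qed

end

section \<open>Eventual vanishing of small one-signed supersolutions\<close>

text \<open>Mean value theorem on unit intervals, over which the increments of a convergent function
  tend to 0. It supplies right endpoints at which the boundary term \<open>y' b\<close> is
  negligible.\<close>

lemma frequently_small_derivative:
  fixes y y' :: "real \<Rightarrow> real"
  assumes dy: "\<And>s. (y has_real_derivative y' s) (at s)"
    and lim: "(y \<longlongrightarrow> l) at_top" and "\<epsilon> > 0"
  obtains b where "b \<ge> R" "y' b \<le> \<epsilon>"
proof -
  have "((\<lambda>s. y (s + 1) - y s) \<longlongrightarrow> l - l) at_top"
    by (intro tendsto_intros lim filterlim_compose[OF lim]) real_asymp
  then have "eventually (\<lambda>s. y (s + 1) - y s < \<epsilon>) at_top"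
    using \<open>\<epsilon> > 0\<close> by (intro order_tendstoD(2)) auto
  then obtain s where s: "s \<ge> R" "y (s + 1) - y s < \<epsilon>"
    using eventually_happens[OF eventually_conj[OF _ eventually_ge_at_top[of R]]] by auto
  obtain z where "z > s" "y (s + 1) - y s = (s + 1 - s) * y' z"
    using MVT2[of s "s + 1" y y'] dy by auto
  then show ?thesis using s by (intro that[of z]) auto
qed

context compact_law
begin

text \<open>As \<open>Q\<close> grows, the weight at \<open>S + D\<close> becomes exponentially
  small relative to the weight at any later fixed point, while the boundary expression grows only
  quadratically. So the estimate leaves no room for a positive integral of \<open>y\<close> beyond
  \<open>S + D\<close>.\<close>

lemma supersolution_vanishes:
  fixes y y' y'' :: "real \<Rightarrow> real"
  assumes dy: "\<And>s. (y has_real_derivative y' s) (at s)"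
    and dy': "\<And>s. (y' has_real_derivative y'' s) (at s)"
    and cy'': "continuous_on UNIV y''"
    and nonneg: "\<And>s. s \<ge> S - D \<Longrightarrow> y s \<ge> 0"
    and le1: "\<And>s. s \<ge> S \<Longrightarrow> y s \<le> 1"
    and lim: "(y \<longlongrightarrow> 0) at_top"
    and ineq: "\<And>s. s \<ge> S \<Longrightarrow> y'' s - c * y' s - y s \<ge> q * (\<integral>\<tau>. y (s - \<tau>) \<partial>M)"
    and gap: "\<And>x. x \<ge> 0 \<Longrightarrow> x\<^sup>2 + c * x - 1 - q' * (\<integral>\<tau>. exp (x * \<tau>) \<partial>M) \<le> - \<delta>"
    and pos: "D > 0" "c > 0" "0 < q'" "q' < q" "\<delta> > 0"
    and t: "t > S + D"
  shows "y t = 0"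
proof (rule ccontr)
  assume "y t \<noteq> 0"
  \<comment> \<open>Chosen so that the loss factor of \<open>gauss_weight_shift\<close> turns
    \<open>q\<close> into exactly \<open>q'\<close>, the coefficient for which \<open>gap\<close> is
    available.\<close>
  define \<rho> where "\<rho> = 2 * ln (q / q') / D\<^sup>2"
  have "\<rho> > 0" using pos by (simp add: \<rho>_def)
  have q': "q * exp (- (\<rho> / 2) * D\<^sup>2) = q'"
    using pos by (simp add: \<rho>_def exp_minus)
  \<comment> \<open>The midpoint, later called \<open>s0\<close>, is strictly above
    \<open>S + D\<close>, which makes \<beta> positive, and strictly below \<open>t\<close>, so that
    \<open>y t \<noteq> 0\<close> forces \<open>I > 0\<close>.\<close>
  define I where "I = integral {(S + D + t) / 2..t} y"
  have cy: "continuous_on A y" for A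
    using dy by (auto intro!: continuous_at_imp_continuous_on DERIV_isCont)
  have "I \<noteq> 0"
    unfolding I_def using t \<open>y t \<noteq> 0\<close> nonneg pos
    by (subst integral_eq_0_iff[OF cy]) (auto intro!: bexI[of _ t])
  moreover have "I \<ge> 0"
    unfolding I_def using t nonneg pos
    by (intro integral_nonneg integrable_continuous_real cy) auto
  ultimately have "I > 0" by simp
  define s0 where "s0 = (S + D + t) / 2"
  define P where "P Q = \<bar>y' S\<bar> + \<rho> * (Q - S) + c + D * ((\<rho> * (Q - S))\<^sup>2 + c * (\<rho> * (Q - S)))" for Q
  \<comment> \<open>Only \<open>y' b\<close> depends on \<open>b\<close>; taking \<open>b\<close>
    with \<open>y' b \<le> \<epsilon>\<close> and letting \<epsilon> tend to 0 removes it.\<close>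
  have est: "\<delta> * gauss_weight \<rho> Q s0 * I \<le> gauss_weight \<rho> Q (S + D) * P Q" if Q: "Q \<ge> t" for Q
  proof (rule field_le_epsilon)
    fix \<epsilon> :: real assume "\<epsilon> > 0"
    then obtain b where b: "b \<ge> Q + D" "y' b \<le> \<epsilon>"
      using frequently_small_derivative[OF dy lim] by metis
    have "\<delta> * gauss_weight \<rho> Q s0 * integral {s0..t} y \<le> y' b + gauss_weight \<rho> Q (S + D) * P Q"
      unfolding P_def
      by (rule weighted_estimate[OF dy dy' cy'' nonneg le1 ineq])
         (use gap pos \<open>\<rho> > 0\<close> Q t b in \<open>auto simp: q'[simplified] s0_def\<close>)
    then show "\<delta> * gauss_weight \<rho> Q s0 * I \<le> gauss_weight \<rho> Q (S + D) * P Q + \<epsilon>"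
      using b by (simp add: I_def s0_def)
  qed
  \<comment> \<open>In the quotient of the weights at \<open>S + D\<close> and \<open>s0\<close> the
    Q^2 terms of the exponents cancel; \<gamma> - \<beta> Q is the exponent that remains.\<close>
  define \<beta> where "\<beta> = \<rho> * (s0 - (S + D))"
  define \<gamma> where "\<gamma> = (\<rho> / 2) * (s0\<^sup>2 - (S + D)\<^sup>2)"
  have "\<beta> > 0" using \<open>\<rho> > 0\<close> t by (simp add: \<beta>_def s0_def)
  have est2: "\<delta> * I \<le> exp (\<gamma> - \<beta> * Q) * P Q" if Q: "Q \<ge> t" for Q
  proof -
    have "Q \<ge> s0" "Q \<ge> S + D" using Q t by (auto simp: s0_def)
    then have "gauss_weight \<rho> Q (S + D) = gauss_weight \<rho> Q s0 * exp (\<gamma> - \<beta> * Q)"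
      unfolding gauss_weight_def exp_add[symmetric]
      by (simp add: \<beta>_def \<gamma>_def algebra_simps power2_eq_square)
    with est[OF Q] have "gauss_weight \<rho> Q s0 * (\<delta> * I) \<le> gauss_weight \<rho> Q s0 * (exp (\<gamma> - \<beta> * Q) * P Q)"
      by (simp add: mult_ac)
    then show ?thesis using gauss_weight_pos by simp
  qed
  have "((\<lambda>Q. exp (\<gamma> - \<beta> * Q) * P Q) \<longlongrightarrow> 0) at_top"
    unfolding P_def using \<open>\<beta> > 0\<close> \<open>\<rho> > 0\<close> pos(1,2) by real_asymp
  moreover have "eventually (\<lambda>Q. \<delta> * I \<le> exp (\<gamma> - \<beta> * Q) * P Q) at_top"
    using eventually_ge_at_top[of t] by eventually_elim (rule est2)
  ultimately have "\<delta> * I \<le> 0"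
    by (intro tendsto_lowerbound) auto
  with pos \<open>I > 0\<close> show False by (simp add: mult_le_0_iff)
qed

section \<open>A uniform gap in the characteristic inequality\<close>

text \<open>Large \<open>x\<close> and bounded \<open>x\<close> are treated separately: exponential
  growth of the moment beats the quadratic even with p / 2 in place of \<open>p\<close>, and on a
  compact interval continuity gives a positive margin, part of which pays for lowering
  \<open>p\<close>.\<close>

lemma characteristic_gap:
  assumes p: "p > 0" and c: "c > 0"
    and neg: "\<And>x. x \<ge> 0 \<Longrightarrow> x\<^sup>2 + c * x - 1 - p * (\<integral>\<tau>. exp (x * \<tau>) \<partial>M) < 0"
  obtains a q' \<delta> where "0 < a" "a \<le> D" "measure M {a..} > 0" "0 < q'" "q' < p" "\<delta> > 0"
    "\<And>x. x \<ge> 0 \<Longrightarrow> x\<^sup>2 + c * x - 1 - q' * (\<integral>\<tau>. exp (x * \<tau>) \<partial>M) \<le> - \<delta>"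
proof -
  let ?k = "\<lambda>x. \<integral>\<tau>. exp (x * \<tau>) \<partial>M"
  have "\<exists>n. measure M {inverse (Suc n)..} > 0"
  proof (rule ccontr)
    assume "\<not> ?thesis"
    then have 0: "measure M {inverse (Suc n)..} = 0" for n
      by (metis less_eq_real_def measure_nonneg)
    have "AE \<tau> in M. \<tau> \<notin> {inverse (Suc n)..}" for n
      by (rule AE_not_in) (use 0 in \<open>auto simp: null_sets_def sets_M emeasure_eq_measure\<close>)
    then have "AE \<tau> in M. \<forall>n. \<tau> \<notin> {inverse (Suc n)..}"
      unfolding AE_all_countable by blast
    then have np: "AE \<tau> in M. \<tau> \<le> 0"
    proof (rule eventually_mono)
      fix \<tau> :: real assume "\<forall>n. \<tau> \<notin> {inverse (Suc n)..}"
      then have "\<not> inverse (real (Suc n)) < \<tau>" for n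
        by (meson atLeast_iff less_imp_le)
      then show "\<tau> \<le> 0" using reals_Archimedean[of \<tau>] by (meson not_le)
    qed
    have k1: "?k x \<le> 1" if "x \<ge> 0" for x
    proof -
      have "?k x \<le> (\<integral>\<tau>. 1 \<partial>M)"
      proof (rule integral_mono_AE)
        show "AE \<tau> in M. exp (x * \<tau>) \<le> 1"
          using np by (rule eventually_mono) (use that in \<open>auto simp: mult_nonneg_nonpos\<close>)
      qed (auto intro!: integrable_continuous continuous_intros)
      then show ?thesis by (simp add: prob_space)
    qed
    \<comment> \<open>Large enough that c x already exceeds 1 + p, the most that can be subtracted
      when the moment is at most 1.\<close>
    let ?x = "(p + 1) / c + p + 1"
    have "c * ?x \<ge> p + 1" using p c by (simp add: field_simps)
    moreover have "p * ?k ?x \<le> p * 1" using k1[of ?x] p c by (intro mult_left_mono) auto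
    moreover have "?x\<^sup>2 \<ge> 0" by simp
    moreover have "?x \<ge> 0" using p c by simp
    ultimately show False using neg[of ?x] by linarith
  qed
  then obtain n where n: "measure M {inverse (Suc n)..} > 0" by blast
  define a where "a = inverse (real (Suc n))"
  have a: "a > 0" "measure M {a..} > 0" using n by (auto simp: a_def)
  have "a \<le> D"
  proof (rule ccontr)
    assume "\<not> a \<le> D"
    then have "AE \<tau> in M. \<tau> \<notin> {a..}"
      using support by (auto elim: eventually_mono)
    then have "measure M {a..} = 0"
      by (subst (asm) AE_iff_measurable[OF _ refl]) (auto simp: sets_M space_M emeasure_eq_measure atLeast_def)
    with a show False by simp
  qed
  let ?\<mu> = "measure M {a..}"
  have k_low: "?\<mu> * exp (x * a) \<le> ?k x" if "x \<ge> 0" for x by (rule exp_moment_lower[OF that])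
  have k_pos: "?k x > 0" if "x \<ge> 0" for x
    using k_low[OF that] a by (meson exp_gt_zero less_le_trans mult_pos_pos)
  define \<mu> where "\<mu> = ?\<mu>"
  have "\<mu> > 0" using a by (simp add: \<mu>_def)
  then have "eventually (\<lambda>x. x\<^sup>2 + c * x \<le> (p / 2) * (\<mu> * exp (x * a))) at_top"
    using p c a(1) by real_asymp
  then obtain X0 where X0: "\<And>x. x \<ge> X0 \<Longrightarrow> x\<^sup>2 + c * x \<le> (p / 2) * (\<mu> * exp (x * a))"
    by (auto simp: eventually_at_top_linorder)
  define X where "X = max 0 X0"
  have cont: "continuous_on A ?k" for A
    by (rule continuous_expectation) (auto simp: case_prod_unfold intro!: continuous_intros)
  have "\<exists>z\<in>{0..X}. \<forall>x\<in>{0..X}. x\<^sup>2 + c * x - 1 - p * ?k x \<le> z\<^sup>2 + c * z - 1 - p * ?k z"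
    by (rule continuous_attains_sup) (auto simp: X_def intro!: continuous_intros cont)
  then obtain z where z: "z \<ge> 0" "\<And>x. x \<in> {0..X} \<Longrightarrow> x\<^sup>2 + c * x - 1 - p * ?k x \<le> z\<^sup>2 + c * z - 1 - p * ?k z"
    by auto
  define d where "d = - (z\<^sup>2 + c * z - 1 - p * ?k z)"
  have "d > 0" using neg[OF z(1)] by (simp add: d_def)
  have "\<exists>w\<in>{0..X}. \<forall>x\<in>{0..X}. ?k x \<le> ?k w"
    by (rule continuous_attains_sup) (auto simp: X_def intro!: cont)
  then obtain w where w: "w \<ge> 0" "\<And>x. x \<in> {0..X} \<Longrightarrow> ?k x \<le> ?k w" by auto
  \<comment> \<open>The first entry serves \<open>x > X\<close>. The second ensures that on
    \<open>{0..X}\<close> the change from \<open>p\<close> to \<open>q'\<close> uses at most half of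
    the margin \<open>d\<close>. In \<delta> the 1 is the constant term of the quadratic, which is
    the whole margin for \<open>x > X\<close>.\<close>
  define q' where "q' = max (p / 2) (p - d / (2 * ?k w))"
  define \<delta> where "\<delta> = min 1 (d / 2)"
  have kw: "?k w > 0" using k_pos w by simp
  have q': "0 < q'" "q' < p" "q' \<ge> p / 2" "q' \<ge> p - d / (2 * ?k w)"
    using p \<open>d > 0\<close> kw by (auto simp: q'_def)
  have "x\<^sup>2 + c * x - 1 - q' * ?k x \<le> - \<delta>" if x: "x \<ge> 0" for x
  proof (cases "x \<le> X")
    case True
    have "(p - q') * ?k x \<le> d / (2 * ?k w) * ?k w"
      using q' w(2)[of x] True x k_pos[of x] kw \<open>d > 0\<close> by (intro mult_mono) auto
    also have "\<dots> = d / 2" using kw by simp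
    finally have "(p - q') * ?k x \<le> d / 2" .
    moreover have "x\<^sup>2 + c * x - 1 - p * ?k x \<le> - d" using z(2)[of x] True x by (simp add: d_def)
    ultimately show ?thesis by (simp add: \<delta>_def algebra_simps)
  next
    case False
    then have "x\<^sup>2 + c * x \<le> (p / 2) * (\<mu> * exp (x * a))" by (intro X0) (auto simp: X_def)
    also have "\<dots> \<le> q' * ?k x"
      using q' k_low[OF x] p \<open>\<mu> > 0\<close> by (intro mult_mono) (auto simp: \<mu>_def)
    finally show ?thesis by (simp add: \<delta>_def)
  qed
  moreover have "\<delta> > 0" using \<open>d > 0\<close> by (simp add: \<delta>_def)
  ultimately show ?thesis using that a \<open>a \<le> D\<close> q' by blast
qed

section \<open>Triviality of one-signed solutions\<close>

text \<open>Linearising \<open>G\<close> at 0 makes \<sigma> v a supersolution, so \<open>v\<close>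
  vanishes near infinity. The zero set is then extended to the left. Since 0 is known to be the only
  zero of \<open>G\<close> just within radius \<open>r\<close>, each extension uses continuity of
  \<open>v\<close> at the edge of its zero set to stay in that range.\<close>

lemma one_signed_solution_trivial:
  fixes v v' v'' G :: "real \<Rightarrow> real"
  assumes dv: "\<And>s. (v has_real_derivative v' s) (at s)"
    and dv': "\<And>s. (v' has_real_derivative v'' s) (at s)"
    and cv'': "continuous_on UNIV v''"
    and lim: "(v \<longlongrightarrow> 0) at_top"
    and G: "continuous_on UNIV G" "G 0 = 0" "(G has_real_derivative - p) (at 0)"
    and eq: "\<And>s. v'' s - c * v' s - v s + (\<integral>\<tau>. G (v (s - \<tau>)) \<partial>M) = 0"
    and pos: "D > 0" "c > 0" "p > 0"
    and neg: "\<And>x. x \<ge> 0 \<Longrightarrow> x\<^sup>2 + c * x - 1 - p * (\<integral>\<tau>. exp (x * \<tau>) \<partial>M) < 0"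
    and sign: "\<bar>\<sigma>\<bar> = 1" "\<And>s. s \<ge> T \<Longrightarrow> \<sigma> * v s \<ge> 0"
  shows "v t = 0"
proof -
  obtain a q' \<delta> where a: "0 < a" "a \<le> D" "measure M {a..} > 0" and q': "0 < q'" "q' < p" and "\<delta> > 0"
    and gap: "\<And>x. x \<ge> 0 \<Longrightarrow> x\<^sup>2 + c * x - 1 - q' * (\<integral>\<tau>. exp (x * \<tau>) \<partial>M) \<le> - \<delta>"
    using characteristic_gap[OF pos(3,2) neg] by metis
  \<comment> \<open>The slack p - q absorbs the linearisation error of \<open>G\<close>, the slack q
    - q' the loss in shifting the weight.\<close>
  define q where "q = (p + q') / 2"
  have q: "q' < q" "q < p" using q' by (auto simp: q_def)
  have cv: "continuous_on A v" for A
    using dv by (auto intro!: continuous_at_imp_continuous_on DERIV_isCont)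
  have "((\<lambda>x. (G x - G 0) / (x - 0)) \<longlongrightarrow> - p) (at 0)"
    using G(3) by (simp add: has_field_derivative_iff)
  then have "eventually (\<lambda>x. dist (G x / x) (- p) < p - q) (at 0)"
    using q G(2) by (auto dest: tendstoD[of _ _ _ "p - q"])
  then obtain r where r: "r > 0" "\<And>x. x \<noteq> 0 \<Longrightarrow> \<bar>x\<bar> < r \<Longrightarrow> \<bar>G x / x + p\<bar> < p - q"
    by (auto simp: eventually_at dist_real_def)
  have Glin: "\<bar>G x + p * x\<bar> \<le> (p - q) * \<bar>x\<bar>" if "\<bar>x\<bar> < r" for x
  proof (cases "x = 0")
    case False
    then have "\<bar>G x + p * x\<bar> = \<bar>G x / x + p\<bar> * \<bar>x\<bar>"
      by (simp add: abs_mult[symmetric] field_simps)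
    also have "\<dots> \<le> (p - q) * \<bar>x\<bar>" using r(2)[OF False that] by (intro mult_right_mono) auto
    finally show ?thesis .
  qed (simp add: G)
  have "eventually (\<lambda>s. \<bar>v s\<bar> < min r 1) at_top"
    using tendstoD[OF lim, of "min r 1"] r(1) by (simp add: dist_real_def)
  then obtain R where R: "\<And>s. s \<ge> R \<Longrightarrow> \<bar>v s\<bar> < min r 1"
    by (auto simp: eventually_at_top_linorder)
  \<comment> \<open>The extra \<open>D\<close> keeps all delayed arguments \<open>s - \<tau>\<close>
    beyond both \<open>R\<close> and \<open>T\<close>.\<close>
  define S where "S = max R T + D"
  have \<sigma>2: "\<sigma> * \<sigma> = 1" using sign(1) by (metis abs_mult_self_eq mult_1)
  have cG [continuous_intros]: "continuous_on A (\<lambda>x. G (w x))" "continuous_on A (\<lambda>x. v (w x))"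
    if "continuous_on A w" for A and w :: "'a::topological_space \<Rightarrow> real"
    using continuous_on_compose2[OF G(1) that] continuous_on_compose2[OF cv that] by auto
  have late: "v s = 0" if s: "s > S + D" for s
  proof -
    have "\<sigma> * v s = 0"
    proof (rule supersolution_vanishes[where y = "\<lambda>s. \<sigma> * v s" and t = s and y' = "\<lambda>s. \<sigma> * v' s" and y'' = "\<lambda>s. \<sigma> * v'' s" and c = c
          and S = S and q = q and q' = q' and \<delta> = \<delta>])
      show "((\<lambda>s. \<sigma> * v s) \<longlongrightarrow> 0) at_top" using tendsto_mult_right_zero[OF lim] .
      show "\<sigma> * v s \<ge> 0" if "s \<ge> S - D" for s using that sign(2) by (simp add: S_def)
      show "\<sigma> * v s \<le> 1" if "s \<ge> S" for s
      proof -
        have "s \<ge> R" using that pos by (simp add: S_def max_def split: if_splits)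
        have "\<sigma> * v s \<le> \<bar>\<sigma> * v s\<bar>" by simp
        also have "\<dots> \<le> 1" using R[OF \<open>s \<ge> R\<close>] by (simp add: abs_mult sign(1))
        finally show ?thesis .
      qed
      show "\<sigma> * v'' s - c * (\<sigma> * v' s) - \<sigma> * v s \<ge> q * (\<integral>\<tau>. \<sigma> * v (s - \<tau>) \<partial>M)" if s: "s \<ge> S" for s
      proof -
        have "q * (\<integral>\<tau>. \<sigma> * v (s - \<tau>) \<partial>M) = (\<integral>\<tau>. q * (\<sigma> * v (s - \<tau>)) \<partial>M)" by simp
        also have "\<dots> \<le> (\<integral>\<tau>. - \<sigma> * G (v (s - \<tau>)) \<partial>M)"
        proof (intro expectation_mono continuous_intros)
          fix \<tau> assume \<tau>: "\<bar>\<tau>\<bar> \<le> D"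
          let ?x = "v (s - \<tau>)"
          have "\<bar>?x\<bar> < r" using R[of "s - \<tau>"] s \<tau> by (simp add: S_def)
          have sx: "\<sigma> * ?x \<ge> 0" using sign(2)[of "s - \<tau>"] s \<tau> by (simp add: S_def)
          have "\<sigma> * (G ?x + p * ?x) \<le> \<bar>\<sigma> * (G ?x + p * ?x)\<bar>" by simp
          also have "\<dots> \<le> (p - q) * \<bar>?x\<bar>"
            using Glin[OF \<open>\<bar>?x\<bar> < r\<close>] by (simp add: abs_mult sign(1))
          also have "\<bar>?x\<bar> = \<sigma> * ?x"
            using sx abs_mult[of \<sigma> ?x] sign(1) by simp
          finally show "q * (\<sigma> * ?x) \<le> - \<sigma> * G ?x" by (simp add: algebra_simps)
        qed
        also have "\<dots> = - \<sigma> * (\<integral>\<tau>. G (v (s - \<tau>)) \<partial>M)" by simp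
        also have "(\<integral>\<tau>. G (v (s - \<tau>)) \<partial>M) = - (v'' s - c * v' s - v s)"
          using eq[of s] by linarith
        finally show ?thesis by (simp add: algebra_simps)
      qed
    qed (use q q' pos \<open>\<delta> > 0\<close> s gap in \<open>auto intro!: DERIV_cmult dv dv' continuous_intros cv''\<close>)
    then show ?thesis using sign(1) by auto
  qed
  define Z where "Z = {T. \<forall>s>T. v s = 0}"
  have "S + D \<in> Z" using late by (simp add: Z_def)
  \<comment> \<open>Convolution vanishing is applied at \<open>T0 + a / 2\<close> rather than at \<open>T0\<close>, so that the equation is only
    used where \<open>v\<close> vanishes in a neighbourhood.\<close>
  have "\<not> bdd_below Z"
  proof
    assume bdd: "bdd_below Z"
    define T0 where "T0 = Inf Z"
    have v0: "v s = 0" if "s > T0" for s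
      using that cInf_less_iff[of Z s] \<open>S + D \<in> Z\<close> bdd by (auto simp: T0_def Z_def)
    have eqT: "(\<integral>\<tau>. G (v (s - \<tau>)) \<partial>M) = 0" if s: "s > T0" for s
    proof -
      have d1: "v' s = 0" if "s > T0" for s
        by (rule DERIV_unique[OF dv])
           (rule has_field_derivative_transform_within_open[of "\<lambda>_. 0" _ _ "{T0<..}"], use that v0 in auto)
      have "v'' s = 0"
        by (rule DERIV_unique[OF dv'])
           (rule has_field_derivative_transform_within_open[of "\<lambda>_. 0" _ _ "{T0<..}"], use s d1 in auto)
      with eq[of s] d1[OF s] v0[OF s] show ?thesis by simp
    qed
    have fz: "G (v s) = 0" if "s \<in> {T0 + a/2 - a<..<T0 + a/2}" for s
      by (rule convolution_vanishing[where f = "\<lambda>s. G (v s)" and T = "T0 + a/2" and a = a])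
         (use that a eqT v0 G in \<open>auto intro!: continuous_intros\<close>)
    have "(v \<longlongrightarrow> v T0) (at_right T0)"
      using cv[of UNIV] by (auto simp: continuous_on_def intro: tendsto_within_subset)
    moreover have "eventually (\<lambda>s. v s = 0) (at_right T0)"
      using eventually_at_right_less[of T0] by eventually_elim (rule v0)
    ultimately have "v T0 = 0"
      using tendsto_unique[of "at_right T0" v "v T0" 0] tendsto_eventually[of v 0 "at_right T0"] by simp
    moreover have "isCont v T0" using cv[of UNIV] by (simp add: continuous_on_eq_continuous_at)
    ultimately obtain e where e: "e > 0" "\<And>s. dist s T0 < e \<Longrightarrow> \<bar>v s\<bar> < r"
      using r(1) by (force simp: continuous_at_eps_delta)
    \<comment> \<open>\<open>e\<close> keeps \<open>v\<close> within the linearisation range, and a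
      / 2 is how far the interval in \<open>fz\<close> reaches to the left of
      \<open>T0\<close>.\<close>
    let ?d = "min e (a / 2)"
    have "v s = 0" if s: "s > T0 - ?d" for s
    proof (cases "s > T0")
      case False
      then have "\<bar>v s\<bar> < r" "G (v s) = 0"
        using s a(1) by (auto intro!: e(2) fz simp: dist_real_def)
      then have "p * \<bar>v s\<bar> \<le> (p - q) * \<bar>v s\<bar>" using Glin[of "v s"] pos by (simp add: abs_mult)
      then have "q * \<bar>v s\<bar> \<le> 0" by (simp add: algebra_simps)
      then show ?thesis using q q' by (simp add: mult_le_0_iff)
    qed (rule v0)
    then have "T0 - ?d \<in> Z" by (simp add: Z_def)
    then have "T0 \<le> T0 - ?d" unfolding T0_def by (rule cInf_lower[OF _ bdd])
    with e a show False by simp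
  qed
  then obtain T1 where "T1 \<in> Z" "T1 < t" by (auto simp: bdd_below_def not_le)
  then show ?thesis by (auto simp: Z_def)
qed

end

section \<open>From the kernel to the delay law\<close>

lemma lebesgue_reflect: "distr lebesgue lebesgue (\<lambda>y. s - y) = (lebesgue :: real measure)"
  using lebesgue_real_affine[of "-1" s] by (simp add: density_1)

lemma measurable_lebesgue_reflect: "(\<lambda>y::real. s - y) \<in> lebesgue \<rightarrow>\<^sub>M lebesgue"
  using lebesgue_affine_measurable[of "\<lambda>_. -1" s] by simp

lemma integrable_lebesgue_reflect:
  fixes f :: "real \<Rightarrow> real"
  assumes "integrable lebesgue f"
  shows "integrable lebesgue (\<lambda>y. f (s - y))"
  using integrable_distr[OF measurable_lebesgue_reflect[of s], of f] assms by (simp add: lebesgue_reflect)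

lemma integral_lebesgue_reflect:
  fixes f :: "real \<Rightarrow> real"
  assumes "integrable lebesgue f"
  shows "(LINT y|lebesgue. f (s - y)) = (LINT w|lebesgue. f w)"
  using integral_distr[OF measurable_lebesgue_reflect[of s], of f] assms
  by (simp add: lebesgue_reflect borel_measurable_integrable)

text \<open>Turns integrals against \<open>K\<close> into expectations. \<open>K\<close> is only
  Lebesgue measurable, so the density is taken over the completed measure and pushed forward to the
  Borel sets. The mass sits in [d - \<eta>, d + \<eta>], which \<open>d \<ge> 0\<close> places
  inside the symmetric interval required by \<open>compact_law\<close>.\<close>

lemma
  fixes K :: "real \<Rightarrow> real"
  assumes nonneg: "\<And>s. K s \<ge> 0"
    and int: "integrable lebesgue K" "(LINT s|lebesgue. K s) = 1"
    and supp: "\<And>s. \<bar>s\<bar> > \<eta> \<Longrightarrow> K s = 0" and d: "d \<ge> 0"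
  defines "M \<equiv> distr (density lebesgue (\<lambda>s. ennreal (K s))) borel (\<lambda>s. d + s)"
  shows shifted_kernel_compact_law: "compact_law M (d + \<eta>)"
    and integral_shifted_kernel:
      "\<And>f :: real \<Rightarrow> real. continuous_on UNIV f \<Longrightarrow> (\<integral>\<tau>. f \<tau> \<partial>M) = (LINT s|lebesgue. K s * f (d + s))"
proof -
  have [measurable]: "K \<in> borel_measurable lebesgue" using int(1) by auto
  have [measurable]: "(\<lambda>s. d + s) \<in> lebesgue \<rightarrow>\<^sub>M borel"
    by (intro measurable_completion) auto
  have "emeasure (density lebesgue (\<lambda>s. ennreal (K s))) UNIV = (\<integral>\<^sup>+ s. ennreal (K s) \<partial>lebesgue)"
    by (subst emeasure_density) auto
  also have "\<dots> = 1"
    using nn_integral_eq_integral[OF int(1)] nonneg int(2) by simp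
  finally have "prob_space (density lebesgue (\<lambda>s. ennreal (K s)))"
    by (intro prob_spaceI) simp
  then have "prob_space M"
    unfolding M_def by (rule prob_space.prob_space_distr) measurable
  moreover have "AE \<tau> in M. \<tau> \<in> {- (d + \<eta>)..d + \<eta>}"
  proof -
    have "d + s \<in> {- (d + \<eta>)..d + \<eta>}" if "K s > 0" for s
      using supp[of s] that d by (cases "\<bar>s\<bar> > \<eta>") auto
    then show ?thesis
      unfolding M_def by (subst AE_distr_iff) (auto simp: AE_density simp del: atLeastAtMost_iff)
  qed
  moreover have "sets M = sets borel" by (simp add: M_def)
  ultimately show "compact_law M (d + \<eta>)"
    by (intro compact_law.intro compact_law_axioms.intro)
  fix f :: "real \<Rightarrow> real" assume f: "continuous_on UNIV f"
  have [measurable]: "f \<in> borel_measurable borel" by (rule borel_measurable_continuous_onI[OF f])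
  have "(\<integral>\<tau>. f \<tau> \<partial>M) = (LINT s|density lebesgue (\<lambda>s. ennreal (K s)). f (d + s))"
    unfolding M_def by (rule integral_distr) measurable
  also have "\<dots> = (LINT s|lebesgue. K s * f (d + s))"
    by (subst integral_density) (auto simp: nonneg)
  finally show "(\<integral>\<tau>. f \<tau> \<partial>M) = (LINT s|lebesgue. K s * f (d + s))" .
qed

section \<open>The profile equation and oscillation\<close>

theorem theorem6:
  fixes h \<eta> \<kappa> c :: real
    and K g \<phi> :: "real \<Rightarrow> real"
    and u :: "real \<Rightarrow> real \<Rightarrow> real"
  assumes "h \<ge> 0" and "\<eta> > 0" and "\<kappa> > 0"
    and "\<And>s. K s \<ge> 0"
    and "integrable lebesgue K" and "(LINT s|lebesgue. K s) = 1"
    and "closure {s. K s \<noteq> 0} \<subseteq> {-\<eta>..\<eta>}"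
    and "continuous_on {0..} g" and "g ` {0..} \<subseteq> {0..}"
    and "g \<kappa> = \<kappa>"
    and "g differentiable (at \<kappa>)" and "deriv g \<kappa> < 0"
    and "c > 0"
    and "\<not> (\<exists>z<0. (z / c)\<^sup>2 - z - 1
               + deriv g \<kappa> * exp (- z * h) * (LINT s:{-\<eta>..\<eta>}|lebesgue. K s * exp (- z * s / c)) = 0)"
    and "\<And>t x. u t x = \<phi> (x + c * t)"
    and "\<And>t x. u t x \<ge> 0"
    and "\<not> (\<exists>a. \<forall>t x. u t x = a)"
    and "classical_solution h K g u"
    and "(\<phi> \<longlongrightarrow> \<kappa>) at_top"
  shows "oscillates_about \<phi> \<kappa>"
proof (rule ccontr)
  assume not_osc: "\<not> oscillates_about \<phi> \<kappa>"
  have K0: "K s = 0" if "\<bar>s\<bar> > \<eta>" for s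
    using assms(7) closure_subset[of "{s. K s \<noteq> 0}"] that by fastforce
  define M where "M = distr (density lebesgue (\<lambda>s. ennreal (K s))) borel (\<lambda>s. c * h + s)"
  define D where "D = c * h + \<eta>"
  have ch: "c * h \<ge> 0" using assms by simp
  interpret compact_law M D
    unfolding M_def D_def by (rule shifted_kernel_compact_law[OF assms(4-6) K0 ch])
  have "D > 0" unfolding D_def using ch assms(2) by linarith
  have LM: "(\<integral>\<tau>. f \<tau> \<partial>M) = (LINT s|lebesgue. K s * f (c * h + s))" if "continuous_on UNIV f" for f :: "real \<Rightarrow> real"
    unfolding M_def by (rule integral_shifted_kernel[OF assms(4-6) K0 ch that])

  obtain ut ux uxx where cuxx: "continuous_on UNIV (\<lambda>(t, x). uxx t x)" and
    all: "\<forall>t x. ((\<lambda>t'. u t' x) has_real_derivative ut t x) (at t) \<and>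
       ((\<lambda>x'. u t x') has_real_derivative ux t x) (at x) \<and>
       ((\<lambda>x'. ux t x') has_real_derivative uxx t x) (at x) \<and>
       integrable lebesgue (\<lambda>y. K (x - y) * g (u (t - h) y)) \<and>
       ut t x = uxx t x - u t x + (LINT y|lebesgue. K (x - y) * g (u (t - h) y))"
    using assms(18) unfolding classical_solution_def by (elim exE conjE) (rule that)
  note sol = all[rule_format, THEN conjunct1] all[rule_format, THEN conjunct2, THEN conjunct1]
    all[rule_format, THEN conjunct2, THEN conjunct2, THEN conjunct1]
    all[rule_format, THEN conjunct2, THEN conjunct2, THEN conjunct2, THEN conjunct1]
    all[rule_format, THEN conjunct2, THEN conjunct2, THEN conjunct2, THEN conjunct2]
  have u: "u = (\<lambda>t x. \<phi> (x + c * t))" using assms(15) by blast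
  \<comment> \<open>At time 0 the solution is the profile itself, so \<open>ux 0\<close> and
    \<open>uxx 0\<close> serve as its first and second derivatives.\<close>
  have d\<phi>: "(\<phi> has_real_derivative ux 0 s) (at s)" for s
    using sol(2)[of 0 s] by (simp add: u)
  have \<phi>0: "\<phi> s \<ge> 0" for s using assms(15)[of 0 s] assms(16)[of 0 s] by simp
  have c\<phi>: "continuous_on UNIV \<phi>"
    using d\<phi> by (auto intro!: continuous_at_imp_continuous_on DERIV_isCont)
  have ut: "ut 0 s = c * ux 0 s" for s
  proof (rule DERIV_unique)
    show "((\<lambda>t. \<phi> (s + c * t)) has_real_derivative ut 0 s) (at 0)"
      using sol(1)[of s 0] by (simp add: u)
    have "((\<lambda>t. s + c * t) has_real_derivative c) (at 0)"
      by (auto intro!: derivative_eq_intros)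
    then show "((\<lambda>t. \<phi> (s + c * t)) has_real_derivative c * ux 0 s) (at 0)"
      using DERIV_chain2[of \<phi> "ux 0 s" "\<lambda>t. s + c * t" 0 c UNIV] d\<phi>[of s] by (simp add: mult.commute)
  qed

  define v where "v s = \<phi> s - \<kappa>" for s
  \<comment> \<open>\<open>g\<close> is only continuous on \<open>[0, \<infinity>)\<close>, hence the truncation.\<close>
  define G where "G x = g (max 0 (\<kappa> + x)) - \<kappa>" for x
  define p where "p = - deriv g \<kappa>"
  have p: "p > 0" using assms by (simp add: p_def)
  have cG: "continuous_on UNIV G"
    unfolding G_def by (intro continuous_intros continuous_on_compose2[OF assms(8)]) auto
  have Gv: "G (v s) = g (\<phi> s) - \<kappa>" for s
    using \<phi>0[of s] by (simp add: G_def v_def)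
  have "(g has_real_derivative - p) (at (0 + \<kappa>))"
    using assms(11) by (simp add: p_def DERIV_deriv_iff_real_differentiable)
  then have "((\<lambda>x. g (x + \<kappa>) - \<kappa>) has_real_derivative - p - 0) (at 0)"
    by (intro DERIV_diff DERIV_const) (simp only: DERIV_shift)
  then have "((\<lambda>x. g (x + \<kappa>) - \<kappa>) has_real_derivative - p) (at 0)" by simp
  \<comment> \<open>Near 0 the argument \<kappa> + x is positive, so the truncation in
    \<open>G\<close> is inactive.\<close>
  then have dG: "(G has_real_derivative - p) (at 0)"
    by (rule has_field_derivative_transform_within_open[of _ _ _ "{-\<kappa><..}"])
       (use assms(3) in \<open>auto simp: G_def add.commute\<close>)
  have cv: "continuous_on UNIV v" unfolding v_def by (intro continuous_intros c\<phi>)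
  \<comment> \<open>The delayed values at time 0 are \<phi> (y - c h); reflecting y = s - w yields
    the total delay c h + w. Unit mass of \<open>K\<close> produces a - \<kappa> that offsets the
    change from \<phi> to \<open>v\<close>.\<close>
  have eq: "uxx 0 s - c * ux 0 s - v s + (\<integral>\<tau>. G (v (s - \<tau>)) \<partial>M) = 0" for s
  proof -
    let ?f = "\<lambda>w. K w * g (\<phi> (s - w - c * h))"
    have "integrable lebesgue (\<lambda>y. ?f (s - y))" and
      e: "ut 0 s = uxx 0 s - \<phi> s + (LINT y|lebesgue. ?f (s - y))"
      using sol(4)[of s 0] sol(5)[of 0 s] by (simp_all add: u)
    have intf: "integrable lebesgue ?f"
      using integrable_lebesgue_reflect[OF \<open>integrable lebesgue (\<lambda>y. ?f (s - y))\<close>, of s] by simp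
    have "(\<integral>\<tau>. G (v (s - \<tau>)) \<partial>M) = (LINT w|lebesgue. K w * G (v (s - (c * h + w))))"
      by (rule LM) (intro continuous_on_compose2[OF cG] continuous_on_compose2[OF cv] continuous_intros, auto)
    also have "\<dots> = (LINT w|lebesgue. ?f w - K w * \<kappa>)"
      by (simp add: Gv algebra_simps)
    also have "\<dots> = (LINT w|lebesgue. ?f w) - \<kappa>"
      using intf assms(5,6) by simp
    also have "(LINT w|lebesgue. ?f w) = (LINT y|lebesgue. ?f (s - y))"
      by (rule integral_lebesgue_reflect[OF intf, symmetric])
    finally show ?thesis using e ut[of s] by (simp add: v_def)
  qed

  define k where "k x = (\<integral>\<tau>. exp (x * \<tau>) \<partial>M)" for x
  have ck: "continuous_on A k" for A
    unfolding k_def by (rule continuous_expectation) (auto simp: case_prod_unfold intro!: continuous_intros)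
  have k: "k x = exp (x * c * h) * (LINT s:{-\<eta>..\<eta>}|lebesgue. K s * exp (x * s))" for x
  proof -
    have "k x = (LINT s|lebesgue. K s * exp (x * (c * h + s)))"
      unfolding k_def by (rule LM) (intro continuous_intros)
    also have "\<dots> = (LINT s|lebesgue. exp (x * c * h) * (indicator {-\<eta>..\<eta>} s * (K s * exp (x * s))))"
    proof (intro Bochner_Integration.integral_cong refl)
      show "K s * exp (x * (c * h + s)) = exp (x * c * h) * (indicator {-\<eta>..\<eta>} s * (K s * exp (x * s)))" for s
        using K0[of s] by (cases "\<bar>s\<bar> > \<eta>") (auto simp: indicator_def exp_add algebra_simps)
    qed
    finally show ?thesis by (simp add: set_lebesgue_integral_def)
  qed
  define \<Psi> where "\<Psi> x = x\<^sup>2 + c * x - 1 - p * k x" for x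
  \<comment> \<open>Under z = - c x the characteristic function becomes \<Psi>, so a positive zero
    of \<Psi> would be a negative root.\<close>
  have \<Psi>_nz: "\<Psi> x \<noteq> 0" if "x > 0" for x
  proof
    assume "\<Psi> x = 0"
    moreover have "- (c * x) < 0" using that assms(13) by simp
    ultimately show False
      using assms(13,14) unfolding \<Psi>_def k p_def
      by (auto simp: algebra_simps dest!: spec[of _ "- (c * x)"])
  qed
  have "k 0 = 1" by (simp add: k_def prob_space)
  then have \<Psi>0: "\<Psi> 0 < 0" using p by (simp add: \<Psi>_def)
  \<comment> \<open>\<Psi> starts at - 1 - p and has no zero, so by the intermediate value theorem
    it keeps its sign.\<close>
  have neg: "\<Psi> x < 0" if x: "x \<ge> 0" for x
  proof (rule ccontr)
    assume "\<not> \<Psi> x < 0"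
    moreover have "continuous_on {0..x} \<Psi>"
      unfolding \<Psi>_def by (intro continuous_intros ck)
    ultimately obtain z where "0 \<le> z" "\<Psi> z = 0"
      using IVT'[of \<Psi> 0 0 x] \<Psi>0 x by auto
    with \<Psi>_nz[of z] \<Psi>0 show False by (cases "z = 0") auto
  qed

  from not_osc obtain T where "(\<forall>s\<ge>T. v s \<le> 0) \<or> (\<forall>s\<ge>T. v s \<ge> 0)"
    unfolding oscillates_about_def v_def by (meson not_less)
  then obtain \<sigma> where \<sigma>: "\<bar>\<sigma>\<bar> = (1::real)" "\<And>s. s \<ge> T \<Longrightarrow> \<sigma> * v s \<ge> 0"
    by (metis abs_1 abs_minus_cancel mult_1 mult_minus1 neg_0_le_iff_le)
  have "v s = 0" for s
  proof (rule one_signed_solution_trivial[OF _ sol(3) _ _ cG _ dG eq _ _ p _ \<sigma>])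
    show "(v has_real_derivative ux 0 s) (at s)" for s
      unfolding v_def using DERIV_diff[OF d\<phi> DERIV_const] by simp
    show "continuous_on UNIV (uxx 0)"
      using continuous_slice(1)[OF cuxx] by simp
    show "(v \<longlongrightarrow> 0) at_top"
      using tendsto_diff[OF assms(19) tendsto_const[of \<kappa>]] by (simp add: v_def[abs_def])
    show "x\<^sup>2 + c * x - 1 - p * (\<integral>\<tau>. exp (x * \<tau>) \<partial>M) < 0" if "x \<ge> 0" for x
      using neg[OF that] by (simp add: \<Psi>_def k_def)
  qed (use \<open>D > 0\<close> assms(3,10,13) in \<open>simp_all add: G_def\<close>)
  then have "\<forall>t x. u t x = \<kappa>" by (simp add: u v_def)
  with assms(17) show False by blast
qed

end
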